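(* Let $V>0$, $W>0$, $w\ge 0$, $A>0$, $B>0$ and $\epsilon_0\in(0,1)$. Then there exist constants $C<\infty$ and $\epsilon_1\in(0,1)$, depending only on $V,W,w,A,B,\epsilon_0$ (in particular not on $n$ and $p$), such that the following holds for all $n,p\in\mathbb{N}$ and all $X=(x_1,\ldots,x_p)\in\mathbb{R}^{n\times p}$. Suppose that $\max_{1\le j\le p}\|x_j\|_2\le 1$, that $$N(\epsilon,X)\le A\,\epsilon^{-V}\quad\text{for all }\epsilon\in(0,\epsilon_0],$$ and that $$M(\epsilon,X)\le B\,\epsilon^{-W}\log^{w}(1/\epsilon)\quad\text{for all }\epsilon\in(0,\epsilon_0].$$ Then $\mathcal{F}:=\mathrm{absconv}(X)$ satisfies $$\mathcal{H}(\epsilon,\mathcal{F})\le C\,\epsilon^{-\frac{2W}{2+W}}\,\log^{\frac{2w}{2+W}}(1/\epsilon)\,\log^{\frac{W}{2+W}}(1/\epsilon)\quad\text{for all }\epsilon\in(0,\epsilon_1].$$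
   Context: A matrix $X=(x_1,\ldots,x_p)\in\mathbb{R}^{n\times p}$ is identified with the set of its columns $\{x_1,\ldots,x_p\}\subset\mathbb{R}^n$. $\mathbb{R}^n$ carries the Euclidean norm $\|\cdot\|_2$ and $\|\cdot\|_1$ is the $\ell_1$-norm. The absolute convex hull is $\mathrm{absconv}(X):=\{X\beta:\ \beta\in\mathbb{R}^p,\ \|\beta\|_1\le 1\}$. Covering numbers and entropy: for a subset $T$ of a metric space and $\epsilon>0$, $N(\epsilon,T)$ is the minimum number of balls of radius $\epsilon$ needed to cover $T$, and $\mathcal{H}(\epsilon,T):=\log N(\epsilon,T)$. Here the metric is the Euclidean one. $N(\epsilon,X)$ is the covering number of the set of columns of $X$. $\epsilon$-approximation: for a linear space $\mathcal{V}\subset\mathbb{R}^n$ let $x^{\mathcal{V}^\perp}$ be the orthogonal projection of $x$ on the orthocomplement of $\mathcal{V}$, and let $\delta(\mathcal{V},X):=\max_{1\le j\le p}\|x_j^{\mathcal{V}^\perp}\|_2$. For $N\in\mathbb{N}$ put $\delta_N(X):=\min\{\delta(\mathcal{V},X):\ \dim(\mathcal{V})=N\}$, and $M(\epsilon,X):=\min\{N:\ \delta_N(X)\le\epsilon\}$. *)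

theory Defs
  imports
    "HOL-Analysis.Abstract_Metric_Spaces"
    "HOL-Analysis.L2_Norm"
    "Jordan_Normal_Form.VS_Connect"
begin

unbundle no vec_syntax

text \<open>
  The constants of the theorem must not depend on the dimensions \<open>n\<close> and \<open>p\<close>, so the dimensions
  have to be quantified inside the formula. Hence vectors and matrices are the carrier-based ones:
  \<open>carrier_vec n\<close> plays the role of \<open>\<real>\<^sup>n\<close>, and \<open>carrier_mat n p\<close> that of the space of
  \<open>n \<times> p\<close> matrices.
\<close>

definition l2_norm :: "real vec \<Rightarrow> real" where
  "l2_norm x = L2_set (\<lambda>i. x $ i) {..<dim_vec x}"

definition l1_norm :: "real vec \<Rightarrow> real" where
  "l1_norm x = (\<Sum>i<dim_vec x. \<bar>x $ i\<bar>)"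

text \<open>
  The second branch is irrelevant on \<open>carrier_vec n\<close>; it is there because \<open>Metric_space\<close> asks for
  symmetry on the whole type.
\<close>
definition l2_dist :: "real vec \<Rightarrow> real vec \<Rightarrow> real" where
  "l2_dist x y = (if dim_vec x = dim_vec y then l2_norm (x - y) else 0)"

lemma Metric_space_l2_dist: "Metric_space (carrier_vec n) l2_dist"
proof
  fix x y z :: "real vec"
  show "0 \<le> l2_dist x y"
    by (simp add: l2_dist_def l2_norm_def)
  show "l2_dist x y = l2_dist y x"
    by (auto simp: l2_dist_def l2_norm_def L2_set_def power2_commute intro!: sum.cong)
next
  fix x y :: "real vec"
  assume "x \<in> carrier_vec n" "y \<in> carrier_vec n"
  then show "l2_dist x y = 0 \<longleftrightarrow> x = y"
    by (auto simp: l2_dist_def l2_norm_def L2_set_eq_0_iff)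
next
  fix x y z :: "real vec"
  assume xyz: "x \<in> carrier_vec n" "y \<in> carrier_vec n" "z \<in> carrier_vec n"
  then have "l2_dist x z = L2_set (\<lambda>i. (x $ i - y $ i) + (y $ i - z $ i)) {..<n}"
    by (auto simp: l2_dist_def l2_norm_def intro!: L2_set_cong)
  also have "\<dots> \<le> L2_set (\<lambda>i. x $ i - y $ i) {..<n} + L2_set (\<lambda>i. y $ i - z $ i) {..<n}"
    by (rule L2_set_triangle_ineq)
  also have "\<dots> = l2_dist x y + l2_dist y z"
    using xyz by (auto simp: l2_dist_def l2_norm_def intro!: arg_cong2[of _ _ _ _ "(+)"] L2_set_cong)
  finally show "l2_dist x z \<le> l2_dist x y + l2_dist y z" .
qed

definition absconv :: "real mat \<Rightarrow> real vec set" where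
  "absconv X = {X *\<^sub>v \<beta> | \<beta>. \<beta> \<in> carrier_vec (dim_col X) \<and> l1_norm \<beta> \<le> 1}"

text \<open>
  Closed balls, with centres anywhere in the metric space \<open>(M, d)\<close>, not only in \<open>T\<close>.
  The minimum is meaningful only if \<open>T\<close> is covered by finitely many balls of radius \<open>\<epsilon>\<close>; this is
  the case for every bounded subset of Euclidean space.
\<close>
definition covering_number ::
    "'a set \<Rightarrow> ('a \<Rightarrow> 'a \<Rightarrow> real) \<Rightarrow> real \<Rightarrow> 'a set \<Rightarrow> nat" where
  "covering_number M d \<epsilon> T =
     (LEAST k. \<exists>S. S \<subseteq> M \<and> finite S \<and> card S = k \<and> T \<subseteq> (\<Union>x\<in>S. Metric_space.mcball M d x \<epsilon>))"

definition entropy ::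
    "'a set \<Rightarrow> ('a \<Rightarrow> 'a \<Rightarrow> real) \<Rightarrow> real \<Rightarrow> 'a set \<Rightarrow> real" where
  "entropy M d \<epsilon> T = ln (real (covering_number M d \<epsilon> T))"

definition subspaces_of_dim :: "nat \<Rightarrow> nat \<Rightarrow> real vec set set" where
  "subspaces_of_dim n N =
     {U. VectorSpace.subspace class_ring U (module_vec TYPE(real) n) \<and>
         vectorspace.dim class_ring ((module_vec TYPE(real) n)\<lparr>carrier := U\<rparr>) = N}"

lemma carrier_vec_in_subspaces_of_dim: "carrier_vec n \<in> subspaces_of_dim n n"
proof -
  interpret vec_space "TYPE(real)" n .
  have "V\<lparr>carrier := carrier_vec n\<rparr> = V"
    by (simp add: module_vec_def)
  then have "vectorspace.dim class_ring (V\<lparr>carrier := carrier_vec n\<rparr>) = n"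
    by (simp only: dim_is_n)
  moreover have "VectorSpace.subspace class_ring (carrier_vec n) V"
    by (simp add: VectorSpace.subspace_def vectorspace_axioms submodule_def module_axioms)
  ultimately show ?thesis
    by (simp only: subspaces_of_dim_def mem_Collect_eq simp_thms)
qed

abbreviation orth_compl :: "nat \<Rightarrow> real vec set \<Rightarrow> real vec set" where
  "orth_compl n U \<equiv> vec_module.orthogonal_complement n U"

definition orth_proj :: "nat \<Rightarrow> real vec set \<Rightarrow> real vec \<Rightarrow> real vec" where
  "orth_proj n U x = (THE y. y \<in> U \<and> x - y \<in> orth_compl n U)"

text \<open>For a matrix without columns the maximum is over the empty set and hence unspecified.\<close>
definition approx_error :: "real vec set \<Rightarrow> real mat \<Rightarrow> real" where
  "approx_error U X =
     (MAX j\<in>{..<dim_col X}. l2_norm (orth_proj (dim_row X) (orth_compl (dim_row X) U) (col X j)))"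

text \<open>
  The infimum is attained (the Grassmannian is compact). For \<open>N > dim_row X\<close> it is over the empty
  set and hence unspecified, but such \<open>N\<close> do not influence \<open>approx_number\<close> at \<open>\<epsilon> > 0\<close>: with at
  least one column, \<open>N = dim_row X\<close> gives error \<open>0\<close>.
\<close>
definition min_approx_error :: "nat \<Rightarrow> real mat \<Rightarrow> real" where
  "min_approx_error N X = (INF U\<in>subspaces_of_dim (dim_row X) N. approx_error U X)"

definition approx_number :: "real \<Rightarrow> real mat \<Rightarrow> nat" where
  "approx_number \<epsilon> X = (LEAST N. min_approx_error N X \<le> \<epsilon>)"

end

theory Submission
  imports Defs "HOL-Analysis.Inner_Product" "HOL-Real_Asymp.Real_Asymp"
begin

text \<open>
  The columns may be replaced by an \<open>\<epsilon>/4\<close>-net chosen among them: this moves the hull by at most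
  \<open>\<epsilon>/2\<close>, and the number of points becomes polynomial in \<open>1/\<epsilon>\<close>. So with \<open>L = log(1/\<epsilon>)\<close> the logarithm
  of the number of points is \<open>O(L)\<close>, whatever \<open>p\<close> is.

  Two facts produce covers of a hull. By sparse approximation (Maurey's lemma,
  \<open>coverable_abs_hull\<close>), the hull of points of norm at most \<open>R\<close> has a cover of radius
  \<open>O(R / sqrt r)\<close> with log-cardinality \<open>O(r L)\<close>. By a volume count (\<open>coverable_halve\<close>), the radius
  of a cover of a set in a \<open>d\<close>-dimensional subspace can be halved at an additional cost \<open>O(d)\<close>.

  Projecting on a single approximating subspace of dimension \<open>N\<close> and covering the projected part by
  volume would cost \<open>N L\<close>, which loses a power of the logarithm. Instead one chains over the scales
  \<open>\<delta>\<^sub>k = 2\<^sup>k \<delta>\<close>. Let \<open>a\<^sub>k\<close> approximate the points up to \<open>O(\<delta>\<^sub>k)\<close> in a subspace of dimension at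
  most \<open>N 2\<^bsup>-kW\<^esup>\<close>, where \<open>N = B L\<^sup>w \<delta>\<^bsup>-W\<^esup>\<close>, and decompose
  \<open>x = (x - a\<^sub>0) + (a\<^sub>0 - a\<^sub>1) + (a\<^sub>1 - a\<^sub>2) + \<dots>\<close>.
  The differences \<open>a\<^sub>k - a\<^sub>k\<^sub>+\<^sub>1\<close> have norm \<open>O(\<delta>\<^sub>k)\<close> and lie in a subspace of dimension at most
  \<open>2 N 2\<^bsup>-kW\<^esup>\<close>. Sparse approximation at the cost \<open>N 2\<^bsup>-kW\<^esup>\<close> covers their hull with a radius of
  order \<open>2\<^bsup>k(1+W/2)\<^esup> \<rho>\<close>, where \<open>\<rho> = \<delta> sqrt (L/N)\<close>, so that \<open>O(k)\<close> halvings bring the radius down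
  to \<open>2\<^bsup>-k\<^esup> \<rho>\<close>. The radii sum to \<open>O(\<rho>)\<close> and the costs, of order \<open>N 2\<^bsup>-kW\<^esup> (1 + k)\<close>, sum to \<open>O(N)\<close>
  (\<open>coverable_chaining\<close>). The equation \<open>\<rho> = const \<epsilon>\<close> determines \<open>\<delta>\<close>, and the resulting \<open>N\<close> is the
  bound of the theorem (\<open>coverable_absconv\<close>).

  Everything up to the chaining bound takes place in an arbitrary real inner product space. To apply
  it for all \<open>n\<close> at once, every \<open>\<real>\<^sup>n\<close> is embedded isometrically in one such space, the finitely
  supported sequences.
\<close>

section \<open>Covers of bounded logarithmic cardinality\<close>

text \<open>
  The parameter \<open>h\<close> bounds the logarithm of the number of balls, so that the bounds for sums of sets
  and for successive refinements are additive in \<open>h\<close>.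
\<close>
definition coverable :: "'a::metric_space set \<Rightarrow> real \<Rightarrow> real \<Rightarrow> bool" where
  "coverable T e h \<longleftrightarrow> (\<exists>S. finite S \<and> real (card S) \<le> exp h \<and> T \<subseteq> (\<Union>s\<in>S. cball s e))"

lemma coverableI:
  assumes "finite S" "real (card S) \<le> exp h" "\<And>x. x \<in> T \<Longrightarrow> \<exists>s\<in>S. dist s x \<le> e"
  shows "coverable T e h"
  unfolding coverable_def using assms by (intro exI[of _ S]) (auto simp: mem_cball)

lemma coverableE:
  assumes "coverable T e h"
  obtains S where "finite S" "real (card S) \<le> exp h" "\<And>x. x \<in> T \<Longrightarrow> \<exists>s\<in>S. dist s x \<le> e"
  using assms unfolding coverable_def by (force simp: mem_cball)

lemma coverable_mono:
  assumes "coverable T e h" "T' \<subseteq> T" "e \<le> e'" "h \<le> h'"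
  shows "coverable T' e' h'"
proof -
  obtain S where S: "finite S" "real (card S) \<le> exp h" "\<And>x. x \<in> T \<Longrightarrow> \<exists>s\<in>S. dist s x \<le> e"
    using assms(1) by (rule coverableE) blast
  show ?thesis
  proof (rule coverableI[OF S(1)])
    show "real (card S) \<le> exp h'"
      using S(2) assms(4) by (meson exp_le_cancel_iff order_trans)
    show "\<exists>s\<in>S. dist s x \<le> e'" if "x \<in> T'" for x
      using S(3)[of x] that assms(2,3) by force
  qed
qed

lemma coverable_near:
  assumes "coverable T e h" "\<And>x. x \<in> T' \<Longrightarrow> \<exists>t\<in>T. dist t x \<le> d"
  shows "coverable T' (e + d) h"
proof -
  obtain S where S: "finite S" "real (card S) \<le> exp h" "\<And>x. x \<in> T \<Longrightarrow> \<exists>s\<in>S. dist s x \<le> e"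
    using assms(1) by (rule coverableE) blast
  show ?thesis
  proof (rule coverableI[OF S(1,2)])
    fix x assume "x \<in> T'"
    then obtain t s where "t \<in> T" "dist t x \<le> d" "s \<in> S" "dist s t \<le> e"
      using assms(2) S(3) by meson
    then show "\<exists>s\<in>S. dist s x \<le> e + d"
      using dist_triangle[of s x t] by force
  qed
qed

lemma coverable_sum:
  fixes T :: "nat \<Rightarrow> 'a::real_normed_vector set"
  assumes "\<And>k. k < K \<Longrightarrow> coverable (T k) (e k) (h k)"
  shows "coverable {\<Sum>k<K. z k | z. \<forall>k<K. z k \<in> T k} (\<Sum>k<K. e k) (\<Sum>k<K. h k)"
  using assms
proof (induction K)
  case 0
  show ?case by (rule coverableI[of "{0}"]) auto
next
  case (Suc K)
  obtain S where S: "finite S" "real (card S) \<le> exp (\<Sum>k<K. h k)"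
    "\<And>x. x \<in> {\<Sum>k<K. z k | z. \<forall>k<K. z k \<in> T k} \<Longrightarrow> \<exists>s\<in>S. dist s x \<le> (\<Sum>k<K. e k)"
    using Suc by (auto elim!: coverableE)
  obtain S' where S': "finite S'" "real (card S') \<le> exp (h K)"
    "\<And>x. x \<in> T K \<Longrightarrow> \<exists>s\<in>S'. dist s x \<le> e K"
    using Suc.prems[of K] by (auto elim!: coverableE)
  show ?case
  proof (rule coverableI)
    let ?S = "(\<lambda>(a, b). a + b) ` (S \<times> S')"
    show "finite ?S" using S S' by simp
    have "card ?S \<le> card S * card S'"
      using card_image_le[of "S \<times> S'" "\<lambda>(a, b). a + b"] S S' by (simp add: card_cartesian_product)
    then have "real (card ?S) \<le> real (card S) * real (card S')"
      by (simp flip: of_nat_mult)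
    also have "\<dots> \<le> exp (\<Sum>k<K. h k) * exp (h K)"
      using S S' by (intro mult_mono) auto
    finally show "real (card ?S) \<le> exp (\<Sum>k<Suc K. h k)" by (simp add: exp_add)
    fix x assume "x \<in> {\<Sum>k<Suc K. z k | z. \<forall>k<Suc K. z k \<in> T k}"
    then obtain z where z: "x = (\<Sum>k<K. z k) + z K" "\<forall>k<Suc K. z k \<in> T k" by auto
    then obtain a b where "a \<in> S" "dist a (\<Sum>k<K. z k) \<le> (\<Sum>k<K. e k)" "b \<in> S'" "dist b (z K) \<le> e K"
      using S(3)[of "\<Sum>k<K. z k"] S'(3)[of "z K"] by fastforce
    then show "\<exists>s\<in>?S. dist s x \<le> (\<Sum>k<Suc K. e k)"
      using dist_triangle_add[of a b "\<Sum>k<K. z k" "z K"] z by (intro bexI[of _ "a + b"]) force+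
  qed
qed

section \<open>Absolute convex hulls\<close>

definition abs_hull :: "'i set \<Rightarrow> ('i \<Rightarrow> 'a::real_vector) \<Rightarrow> 'a set" where
  "abs_hull J y = {\<Sum>j\<in>J. \<beta> j *\<^sub>R y j | \<beta>. (\<Sum>j\<in>J. \<bar>\<beta> j\<bar>) \<le> 1}"

lemma abs_hull_norm_le:
  fixes y :: "'i \<Rightarrow> 'a::real_normed_vector"
  assumes "z \<in> abs_hull J y" "\<And>j. j \<in> J \<Longrightarrow> norm (y j) \<le> R" "0 \<le> R"
  shows "norm z \<le> R"
proof -
  obtain \<beta> where z: "z = (\<Sum>j\<in>J. \<beta> j *\<^sub>R y j)" and \<beta>: "(\<Sum>j\<in>J. \<bar>\<beta> j\<bar>) \<le> 1"
    using assms(1) unfolding abs_hull_def by blast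
  have "norm z \<le> (\<Sum>j\<in>J. norm (\<beta> j *\<^sub>R y j))" unfolding z by (rule norm_sum)
  also have "\<dots> \<le> (\<Sum>j\<in>J. \<bar>\<beta> j\<bar> * R)"
    by (rule sum_mono) (use assms in \<open>auto intro: mult_left_mono\<close>)
  also have "\<dots> = (\<Sum>j\<in>J. \<bar>\<beta> j\<bar>) * R" by (simp add: sum_distrib_right)
  also have "\<dots> \<le> R" using mult_right_mono[OF \<beta> assms(3)] by simp
  finally show ?thesis .
qed

text \<open>
  Moving each generator by at most \<open>d\<close> moves the hull by at most \<open>d\<close>: a combination of the \<open>x j\<close> and the
  combination of the \<open>y j\<close> with the same coefficients differ by an element of the hull of the
  differences \<open>x j - y j\<close>.
\<close>
lemma abs_hull_near:
  fixes x y :: "'i \<Rightarrow> 'a::real_normed_vector"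
  assumes "\<And>j. j \<in> J \<Longrightarrow> norm (x j - y j) \<le> d" "0 \<le> d" "z \<in> abs_hull J x"
  shows "\<exists>t\<in>abs_hull J y. dist t z \<le> d"
proof -
  obtain \<beta> where z: "z = (\<Sum>j\<in>J. \<beta> j *\<^sub>R x j)" and \<beta>: "(\<Sum>j\<in>J. \<bar>\<beta> j\<bar>) \<le> 1"
    using assms(3) unfolding abs_hull_def by blast
  have "(\<Sum>j\<in>J. \<beta> j *\<^sub>R (x j - y j)) \<in> abs_hull J (\<lambda>j. x j - y j)"
    using \<beta> by (auto simp: abs_hull_def)
  then have "norm (\<Sum>j\<in>J. \<beta> j *\<^sub>R (x j - y j)) \<le> d"
    by (rule abs_hull_norm_le) (use assms in auto)
  then have "dist (\<Sum>j\<in>J. \<beta> j *\<^sub>R y j) z \<le> d"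
    by (simp add: z dist_norm norm_minus_commute scaleR_diff_right sum_subtractf)
  moreover have "(\<Sum>j\<in>J. \<beta> j *\<^sub>R y j) \<in> abs_hull J y" using \<beta> by (auto simp: abs_hull_def)
  ultimately show ?thesis by blast
qed

lemma abs_hull_sum_subset:
  "abs_hull J (\<lambda>j. \<Sum>k<K. y k j) \<subseteq> {\<Sum>k<K. z k | z. \<forall>k<K. z k \<in> abs_hull J (y k)}"
proof
  fix x assume "x \<in> abs_hull J (\<lambda>j. \<Sum>k<K. y k j)"
  then obtain \<beta> where x: "x = (\<Sum>j\<in>J. \<beta> j *\<^sub>R (\<Sum>k<K. y k j))" and \<beta>: "(\<Sum>j\<in>J. \<bar>\<beta> j\<bar>) \<le> 1"
    by (auto simp: abs_hull_def)
  have "x = (\<Sum>k<K. \<Sum>j\<in>J. \<beta> j *\<^sub>R y k j)"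
    unfolding x scaleR_sum_right by (rule sum.swap)
  moreover have "(\<Sum>j\<in>J. \<beta> j *\<^sub>R y k j) \<in> abs_hull J (y k)" for k
    using \<beta> by (auto simp: abs_hull_def)
  ultimately show "x \<in> {\<Sum>k<K. z k | z. \<forall>k<K. z k \<in> abs_hull J (y k)}"
    by (intro CollectI exI[of _ "\<lambda>k. \<Sum>j\<in>J. \<beta> j *\<^sub>R y k j"]) simp
qed

lemma abs_hull_subset_span:
  assumes "\<And>j. j \<in> J \<Longrightarrow> y j \<in> span F"
  shows "abs_hull J y \<subseteq> span F"
  unfolding abs_hull_def using assms
  by (auto intro!: real_vector.span_sum real_vector.span_scale)

section \<open>Sparse approximation of convex combinations\<close>

text \<open>
  A linear functional on the hull is maximised at a signed generator; the origin serves the case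
  of no generators.
\<close>
lemma abs_hull_inner_le_generator:
  fixes y :: "'i \<Rightarrow> 'a::real_inner"
  assumes "finite J" "z \<in> abs_hull J y"
  shows "\<exists>s \<in> insert 0 (y ` J \<union> uminus ` y ` J). inner e z \<le> inner e s"
proof (cases "J = {}")
  case True
  with assms show ?thesis by (auto simp: abs_hull_def)
next
  case False
  obtain \<beta> where z: "z = (\<Sum>j\<in>J. \<beta> j *\<^sub>R y j)" and \<beta>: "(\<Sum>j\<in>J. \<bar>\<beta> j\<bar>) \<le> 1"
    using assms(2) unfolding abs_hull_def by blast
  define M where "M = Max ((\<lambda>j. \<bar>inner e (y j)\<bar>) ` J)"
  have M: "M \<in> (\<lambda>j. \<bar>inner e (y j)\<bar>) ` J"
    unfolding M_def by (rule Max_in) (use assms False in auto)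
  then obtain j where j: "j \<in> J" "M = \<bar>inner e (y j)\<bar>" by blast
  have "inner e z = (\<Sum>j\<in>J. \<beta> j * inner e (y j))"
    by (simp add: z inner_sum_right)
  also have "\<dots> \<le> (\<Sum>j\<in>J. \<bar>\<beta> j\<bar> * M)"
  proof (rule sum_mono)
    fix i assume "i \<in> J"
    then have "\<bar>inner e (y i)\<bar> \<le> M" unfolding M_def using assms by (intro Max_ge) auto
    then have "\<bar>\<beta> i\<bar> * \<bar>inner e (y i)\<bar> \<le> \<bar>\<beta> i\<bar> * M" by (intro mult_left_mono) auto
    then show "\<beta> i * inner e (y i) \<le> \<bar>\<beta> i\<bar> * M" by (metis abs_ge_self abs_mult order_trans)
  qed
  also have "\<dots> = (\<Sum>j\<in>J. \<bar>\<beta> j\<bar>) * M" by (simp add: sum_distrib_right)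
  also have "\<dots> \<le> M" using mult_right_mono[OF \<beta>, of M] j by simp
  finally have "inner e z \<le> inner e (y j) \<or> inner e z \<le> inner e (- y j)"
    using j by (auto simp: abs_if split: if_splits)
  with j show ?thesis by blast
qed

text \<open>
  A greedy, deterministic form of Maurey's lemma. If the error after \<open>r\<close> steps is \<open>e = r z - sum_list xs\<close>,
  choose the next \<open>s\<close> among the signed generators with \<open>inner e (z - s) \<le> 0\<close>. The cross term in
  \<open>(norm (e + (z - s)))\<^sup>2\<close> is then nonpositive, and the squared error grows by at most \<open>(2 R)\<^sup>2\<close> per step,
  hence linearly instead of quadratically in \<open>r\<close>.
\<close>
lemma sparse_approximation:
  fixes y :: "'i \<Rightarrow> 'a::real_inner"
  assumes J: "finite J" and z: "z \<in> abs_hull J y"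
    and R: "\<And>j. j \<in> J \<Longrightarrow> norm (y j) \<le> R" "0 \<le> R"
  shows "\<exists>xs. length xs = r \<and> set xs \<subseteq> insert 0 (y ` J \<union> uminus ` y ` J) \<and>
    (norm (real r *\<^sub>R z - sum_list xs))\<^sup>2 \<le> real r * (2 * R)\<^sup>2"
proof (induction r)
  case 0
  then show ?case by simp
next
  case (Suc r)
  then obtain xs where xs: "length xs = r" "set xs \<subseteq> insert 0 (y ` J \<union> uminus ` y ` J)"
    and le: "(norm (real r *\<^sub>R z - sum_list xs))\<^sup>2 \<le> real r * (2 * R)\<^sup>2" by blast
  define e where "e = real r *\<^sub>R z - sum_list xs"
  obtain s where s: "s \<in> insert 0 (y ` J \<union> uminus ` y ` J)" "inner e z \<le> inner e s"
    using abs_hull_inner_le_generator[OF J z] by blast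
  have "norm s \<le> R" using s R by auto
  then have zs: "norm (z - s) \<le> 2 * R"
    using norm_triangle_ineq4[of z s] abs_hull_norm_le[OF z R] by simp
  have eq: "real (Suc r) *\<^sub>R z - sum_list (s # xs) = e + (z - s)"
    by (simp add: e_def algebra_simps)
  have "(norm (e + (z - s)))\<^sup>2 = (norm e)\<^sup>2 + 2 * inner e (z - s) + (norm (z - s))\<^sup>2"
    by (simp add: power2_norm_eq_inner inner_add_left inner_add_right inner_commute)
  also have "\<dots> \<le> real r * (2 * R)\<^sup>2 + (2 * R)\<^sup>2"
    using le s zs power_mono[OF zs norm_ge_zero, of 2] by (simp add: e_def[symmetric] inner_diff_right)
  finally have "(norm (real (Suc r) *\<^sub>R z - sum_list (s # xs)))\<^sup>2 \<le> real (Suc r) * (2 * R)\<^sup>2"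
    unfolding eq by (simp add: algebra_simps)
  then show ?case using xs s by (intro exI[of _ "s # xs"]) auto
qed

text \<open>
  The centres are the averages of \<open>r\<close> signed generators. Only distinct generators count, which is why
  the bound involves \<open>card (y ` J)\<close> and not \<open>card J\<close>.
\<close>
lemma coverable_abs_hull_nat:
  fixes y :: "'i \<Rightarrow> 'a::real_inner"
  assumes J: "finite J" and R: "\<And>j. j \<in> J \<Longrightarrow> norm (y j) \<le> R" "0 \<le> R"
    and r: "r > 0" and L: "ln (2 * real (card (y ` J)) + 1) \<le> L"
  shows "coverable (abs_hull J y) (2 * R / sqrt (real r)) (real r * L)"
proof (rule coverableI)
  let ?D = "insert 0 (y ` J \<union> uminus ` y ` J)"
  let ?X = "{xs. set xs \<subseteq> ?D \<and> length xs = r}"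
  let ?S = "(\<lambda>xs. (1 / real r) *\<^sub>R sum_list xs) ` ?X"
  have finD: "finite ?D" using J by simp
  then have finX: "finite ?X" by (rule finite_lists_length_eq)
  then show "finite ?S" by simp
  have "card ?D \<le> Suc (card (y ` J \<union> uminus ` y ` J))" by (rule card_insert_le_m1) (auto simp: card_insert_if J)
  also have "card (y ` J \<union> uminus ` y ` J) \<le> card (y ` J) + card (uminus ` y ` J)" by (rule card_Un_le)
  also have "card (uminus ` y ` J) \<le> card (y ` J)" by (rule card_image_le) (use J in simp)
  finally have D: "card ?D \<le> 2 * card (y ` J) + 1" by simp
  have "card ?S \<le> card ?X" by (rule card_image_le[OF finX])
  also have "\<dots> = card ?D ^ r" by (rule card_lists_length_eq[OF finD])
  also have "\<dots> \<le> (2 * card (y ` J) + 1) ^ r" by (rule power_mono[OF D]) simp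
  finally have "real (card ?S) \<le> real ((2 * card (y ` J) + 1) ^ r)" by (simp only: of_nat_le_iff)
  also have "\<dots> = (2 * real (card (y ` J)) + 1) ^ r" by (simp add: add.commute)
  also have "\<dots> = exp (ln (2 * real (card (y ` J)) + 1)) ^ r" by (subst exp_ln) auto
  also have "\<dots> \<le> exp L ^ r" using L by (intro power_mono) (simp_all only: exp_le_cancel_iff exp_ge_zero)
  also have "\<dots> = exp (real r * L)" by (simp add: exp_of_nat_mult)
  finally show "real (card ?S) \<le> exp (real r * L)" .
  fix z assume z: "z \<in> abs_hull J y"
  obtain xs where xs: "length xs = r" "set xs \<subseteq> ?D"
    "(norm (real r *\<^sub>R z - sum_list xs))\<^sup>2 \<le> real r * (2 * R)\<^sup>2"
    using sparse_approximation[OF J z R, of r] by auto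
  have "norm (real r *\<^sub>R z - sum_list xs) \<le> sqrt (real r * (2 * R)\<^sup>2)"
    by (rule real_le_rsqrt[OF xs(3)])
  also have "\<dots> = sqrt (real r) * (2 * R)" using R by (simp add: real_sqrt_mult)
  finally have "norm (real r *\<^sub>R z - sum_list xs) / real r \<le> sqrt (real r) * (2 * R) / real r"
    by (rule divide_right_mono) simp
  also have "\<dots> = 2 * R / sqrt (real r)" using r by (simp add: field_simps)
  also have "norm (real r *\<^sub>R z - sum_list xs) / real r = norm ((1 / real r) *\<^sub>R (real r *\<^sub>R z - sum_list xs))"
    by simp
  also have "(1 / real r) *\<^sub>R (real r *\<^sub>R z - sum_list xs) = z - (1 / real r) *\<^sub>R sum_list xs"
    using r by (simp add: scaleR_diff_right)
  finally have "dist ((1 / real r) *\<^sub>R sum_list xs) z \<le> 2 * R / sqrt (real r)"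
    by (simp add: dist_norm norm_minus_commute)
  then show "\<exists>s\<in>?S. dist s z \<le> 2 * R / sqrt (real r)" using xs by blast
qed

text \<open>
  The number of steps may be real. For \<open>r < 1\<close> one ball around the origin is enough; this saves the
  additional cost \<open>L\<close> that rounding up would have at each scale of the chaining argument.
\<close>
lemma coverable_abs_hull:
  fixes y :: "'i \<Rightarrow> 'a::real_inner"
  assumes J: "finite J" and R: "\<And>j. j \<in> J \<Longrightarrow> norm (y j) \<le> R" "0 \<le> R"
    and r: "r > 0" and L: "ln (2 * real (card (y ` J)) + 1) \<le> L"
  shows "coverable (abs_hull J y) (3 * R / sqrt r) (r * L)"
proof -
  have L0: "0 \<le> L" using L ln_ge_zero[of "2 * real (card (y ` J)) + 1"] by linarith
  show ?thesis
  proof (cases "r < 1")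
    case True
    have "sqrt r \<le> 1" using True r by simp
    then have "R * sqrt r \<le> 3 * R" using mult_left_mono[of "sqrt r" 1 R] R(2) by linarith
    then have *: "R \<le> 3 * R / sqrt r" using r by (simp add: field_simps)
    show ?thesis
    proof (rule coverableI[of "{0}"])
      show "real (card {0}) \<le> exp (r * L)" using r L0 by simp
      show "\<exists>s\<in>{0}. dist s x \<le> 3 * R / sqrt r" if "x \<in> abs_hull J y" for x
        using abs_hull_norm_le[OF that R] * by simp
    qed simp
  next
    case False
    \<comment> \<open>Rounding down at most halves \<open>r\<close>, which turns the factor 2 into \<open>2 * sqrt 2 \<le> 3\<close>.\<close>
    define k where "k = nat \<lfloor>r\<rfloor>"
    have "real k = of_int \<lfloor>r\<rfloor>" "\<lfloor>r\<rfloor> \<ge> 1" using False by (simp_all add: k_def le_floor_iff)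
    then have k: "k > 0" "real k \<le> r" "r \<le> 2 * real k" by linarith+
    have "coverable (abs_hull J y) (2 * R / sqrt (real k)) (real k * L)"
      by (rule coverable_abs_hull_nat[OF J R k(1) L])
    moreover have "real k * L \<le> r * L" using k L0 by (intro mult_right_mono) auto
    moreover have "2 * R / sqrt (real k) \<le> 3 * R / sqrt r"
    proof -
      have "2 * sqrt r = sqrt (4 * r)" by (simp add: real_sqrt_mult)
      also have "\<dots> \<le> sqrt (9 * real k)" using k by (intro real_sqrt_le_mono) linarith
      also have "\<dots> = 3 * sqrt (real k)" by (simp add: real_sqrt_mult)
      finally have "R * (2 * sqrt r) \<le> R * (3 * sqrt (real k))" by (rule mult_left_mono[OF _ R(2)])
      then show ?thesis using r k by (simp add: field_simps)
    qed
    ultimately show ?thesis using coverable_mono[OF _ subset_refl] by blast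
  qed
qed

section \<open>Counting lattice points\<close>

lemma sum_power_half_abs_le: "(\<Sum>a\<in>{-int M..int M}. (1/2::real) ^ nat \<bar>a\<bar>) \<le> 3"
proof -
  have "(\<Sum>a\<in>{-int M..int M}. (1/2::real) ^ nat \<bar>a\<bar>) = 3 - 2 * (1/2) ^ M"
  proof (induction M)
    case (Suc M)
    have "{-int (Suc M)..int (Suc M)} = insert (-int (Suc M)) (insert (int (Suc M)) {-int M..int M})"
      by auto
    then have "(\<Sum>a\<in>{-int (Suc M)..int (Suc M)}. (1/2::real) ^ nat \<bar>a\<bar>) =
      (1/2) ^ Suc M + ((1/2) ^ Suc M + (\<Sum>a\<in>{-int M..int M}. (1/2) ^ nat \<bar>a\<bar>))"
      by (simp add: nat_add_distrib)
    then show ?case using Suc by simp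
  qed simp
  then show ?thesis by simp
qed

text \<open>
  The lattice points of the \<open>l\<^sup>1\<close>-ball are counted with the weights \<open>2 ^ M / 2 ^ (\<Sum>e. \<bar>z e\<bar>)\<close>: they are at
  least 1 on the ball, and their sum over the cube factorises over the coordinates.
\<close>
lemma card_lattice_points_le:
  fixes E :: "'e set" and M :: nat
  assumes E: "finite E"
  defines "Z \<equiv> {z \<in> E \<rightarrow>\<^sub>E (UNIV :: int set). (\<Sum>e\<in>E. \<bar>z e\<bar>) \<le> int M}"
  shows "finite Z" "real (card Z) \<le> 2 ^ M * 3 ^ card E"
proof -
  let ?B = "E \<rightarrow>\<^sub>E {-int M..int M}"
  have sub: "Z \<subseteq> ?B"
  proof
    fix z assume z: "z \<in> Z"
    have "\<bar>z e\<bar> \<le> int M" if "e \<in> E" for e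
      using member_le_sum[OF that, of "\<lambda>e. \<bar>z e\<bar>"] E z by (auto simp: Z_def)
    then show "z \<in> ?B" using z by (force simp: Z_def PiE_iff abs_le_iff)
  qed
  have finB: "finite ?B" using E by (intro finite_PiE) auto
  show "finite Z" by (rule finite_subset[OF sub finB])
  have "real (card Z) = (\<Sum>z\<in>Z. 1)" by simp
  also have "\<dots> \<le> (\<Sum>z\<in>Z. 2 ^ M * (\<Prod>e\<in>E. (1/2) ^ nat \<bar>z e\<bar>))"
  proof (rule sum_mono)
    fix z assume z: "z \<in> Z"
    have "(\<Sum>e\<in>E. nat \<bar>z e\<bar>) \<le> M"
    proof -
      have "int (\<Sum>e\<in>E. nat \<bar>z e\<bar>) \<le> int M" using z by (simp add: Z_def)
      then show ?thesis by (simp only: of_nat_le_iff)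
    qed
    then have "(1/2::real) ^ M \<le> (1/2) ^ (\<Sum>e\<in>E. nat \<bar>z e\<bar>)" by (intro power_decreasing) auto
    then have "2 ^ M * (1/2::real) ^ M \<le> 2 ^ M * (1/2) ^ (\<Sum>e\<in>E. nat \<bar>z e\<bar>)" by (intro mult_left_mono) auto
    then show "(1::real) \<le> 2 ^ M * (\<Prod>e\<in>E. (1/2) ^ nat \<bar>z e\<bar>)"
      by (simp add: power_sum flip: power_mult_distrib)
  qed
  also have "\<dots> \<le> (\<Sum>z\<in>?B. 2 ^ M * (\<Prod>e\<in>E. (1/2) ^ nat \<bar>z e\<bar>))"
    by (rule sum_mono2[OF finB sub]) (simp add: prod_nonneg)
  also have "\<dots> = 2 ^ M * (\<Prod>e\<in>E. \<Sum>a\<in>{-int M..int M}. (1/2) ^ nat \<bar>a\<bar>)"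
    using E by (subst prod_sum_PiE) (auto simp: sum_distrib_left)
  also have "\<dots> \<le> 2 ^ M * 3 ^ card E"
  proof -
    have "(\<Prod>e\<in>E. \<Sum>a\<in>{-int M..int M}. (1/2::real) ^ nat \<bar>a\<bar>) \<le> (\<Prod>e\<in>E. 3)"
      by (rule prod_mono) (simp add: sum_power_half_abs_le sum_nonneg)
    then show ?thesis by simp
  qed
  finally show "real (card Z) \<le> 2 ^ M * 3 ^ card E" .
qed

section \<open>Orthonormal systems\<close>

definition orthonormal :: "'a::real_inner set \<Rightarrow> bool" where
  "orthonormal E \<longleftrightarrow> (\<forall>e\<in>E. \<forall>f\<in>E. inner e f = (if e = f then 1 else 0))"

text \<open>
  For an orthonormal \<open>E\<close> this is the orthogonal projection onto its span, expressed by the Fourier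
  coefficients.
\<close>
definition proj_onto :: "'a::real_inner set \<Rightarrow> 'a \<Rightarrow> 'a" where
  "proj_onto E x = (\<Sum>e\<in>E. inner x e *\<^sub>R e)"

lemma proj_onto_in_span: "proj_onto E x \<in> span E"
  unfolding proj_onto_def by (intro real_vector.span_sum real_vector.span_scale real_vector.span_base)

lemma inner_residual:
  assumes "finite E" "orthonormal E" "e \<in> E"
  shows "inner (x - proj_onto E x) e = 0"
proof -
  have "inner (proj_onto E x) e = (\<Sum>f\<in>E. inner x f * (if f = e then 1 else 0))"
    unfolding proj_onto_def inner_sum_left inner_scaleR_left
    by (rule sum.cong) (use assms in \<open>auto simp: orthonormal_def\<close>)
  also have "\<dots> = inner x e" using assms by (simp add: sum.delta' if_distrib cong: if_cong)
  finally show ?thesis by (simp add: inner_diff_left)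
qed

lemma inner_residual_span:
  assumes "finite E" "orthonormal E" "u \<in> span E"
  shows "inner (x - proj_onto E x) u = 0"
  using assms(3)
proof (induction rule: real_vector.span_induct_alt)
  case base
  show ?case by simp
next
  case (step c e y)
  then show ?case using inner_residual[OF assms(1,2)] by (simp add: inner_add_right)
qed

lemma proj_onto_fixes_span:
  assumes "finite E" "orthonormal E" "u \<in> span E"
  shows "proj_onto E u = u"
proof -
  have "u - proj_onto E u \<in> span E"
    by (rule real_vector.span_diff[OF assms(3) proj_onto_in_span])
  from inner_residual_span[OF assms(1,2) this, of u] show ?thesis by simp
qed

text \<open>
  Gram-Schmidt: the residual of a new vector with respect to the system found so far is either zero or,
  after normalisation, the next basis vector.
\<close>
lemma orthonormal_span_exists:
  fixes F :: "'a::real_inner set"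
  assumes "finite F"
  shows "\<exists>E. finite E \<and> card E \<le> card F \<and> orthonormal E \<and>
    span E = span F"
  using assms
proof (induction F)
  case empty
  show ?case by (rule exI[of _ "{}"]) (simp add: orthonormal_def)
next
  case (insert v F)
  then obtain E where E: "finite E" "card E \<le> card F" "orthonormal E"
    "span E = span F" by blast
  define w where "w = v - proj_onto E v"
  have v: "v = w + proj_onto E v" by (simp add: w_def)
  show ?case
  proof (cases "w = 0")
    case True
    then have "v \<in> span F" using v proj_onto_in_span[of E v] E(4) by simp
    then have "span (insert v F) = span F"
      by (rule real_vector.span_redundant)
    with E insert show ?thesis by (intro exI[of _ E]) auto
  next
    case False
    define n where "n = (1 / norm w) *\<^sub>R w"
    have n1: "inner n n = 1" using False by (simp add: n_def power2_norm_eq_inner[symmetric] power2_eq_square)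
    have n0: "inner n e = 0" if "e \<in> E" for e
      using inner_residual[OF E(1,3) that] by (simp add: n_def w_def)
    have nE: "n \<notin> E" using n0 n1 by auto
    have on: "orthonormal (insert n E)"
      using E(3) n0 n1 nE by (auto simp: orthonormal_def inner_commute)
    have wn: "w = norm w *\<^sub>R n" using False by (simp add: n_def)
    have "span (insert n E) = span (insert v F)"
    proof (rule antisym)
      show "span (insert n E) \<subseteq> span (insert v F)"
      proof (rule real_vector.span_minimal[OF _ real_vector.subspace_span])
        have sub: "span E \<subseteq> span (insert v F)"
          unfolding E(4) by (rule real_vector.span_mono) auto
        moreover have "n \<in> span (insert v F)"
          unfolding n_def w_def using sub proj_onto_in_span[of E v]
          by (intro real_vector.span_scale real_vector.span_diff) (auto intro: real_vector.span_base)
        ultimately show "insert n E \<subseteq> span (insert v F)"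
          using real_vector.span_superset[of E] by auto
      qed
      show "span (insert v F) \<subseteq> span (insert n E)"
      proof (rule real_vector.span_minimal[OF _ real_vector.subspace_span])
        have sub: "span E \<subseteq> span (insert n E)"
          by (rule real_vector.span_mono) auto
        moreover have "v \<in> span (insert n E)"
        proof -
          have "norm w *\<^sub>R n + proj_onto E v \<in> span (insert n E)"
            using sub proj_onto_in_span[of E v]
            by (intro real_vector.span_add real_vector.span_scale) (auto intro: real_vector.span_base)
          then show ?thesis using v wn by simp
        qed
        ultimately show "insert v F \<subseteq> span (insert n E)"
          using real_vector.span_superset[of F] E(4) by auto
      qed
    qed
    then show ?thesis using E insert on nE by (intro exI[of _ "insert n E"]) auto
  qed
qed

lemma norm_orthonormal_sum:
  assumes "finite E" "orthonormal E"
  shows "(norm (\<Sum>e\<in>E. c e *\<^sub>R e))\<^sup>2 = (\<Sum>e\<in>E. (c e)\<^sup>2)"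
proof -
  have "(norm (\<Sum>e\<in>E. c e *\<^sub>R e))\<^sup>2 = (\<Sum>e\<in>E. \<Sum>f\<in>E. c e * (c f * (if e = f then 1 else 0)))"
    unfolding power2_norm_eq_inner inner_sum_left inner_sum_right inner_scaleR_left inner_scaleR_right
    sum_distrib_left
    by (intro sum.cong refl) (use assms(2) in \<open>auto simp: orthonormal_def\<close>)
  also have "\<dots> = (\<Sum>e\<in>E. (c e)\<^sup>2)"
    using assms(1) by (simp add: sum.delta if_distrib power2_eq_square cong: if_cong)
  finally show ?thesis .
qed

section \<open>Refining a cover inside a finite-dimensional subspace\<close>

text \<open>
  In orthonormal coordinates, round every coordinate to a grid of mesh \<open>\<rho> / (4 sqrt m)\<close>; the rounding
  error has norm at most \<open>\<rho> / 4\<close>. By Cauchy-Schwarz the grid points reached lie in an \<open>l\<^sup>1\<close>-ball of radius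
  proportional to the dimension \<open>m\<close>. There are only exponentially many of these, whereas the cube
  containing the ball would contribute a factor of order \<open>sqrt m\<close> per coordinate.
\<close>
lemma coverable_ball_span:
  fixes F :: "'a::real_inner set"
  assumes F: "finite F" "real (card F) \<le> d" and \<rho>: "\<rho> > 0"
  shows "coverable (span F \<inter> cball 0 \<rho>) (\<rho> / 4) (d * ln 96)"
proof -
  obtain E where E: "finite E" "card E \<le> card F" "orthonormal E"
    "span E = span F"
    using orthonormal_span_exists[OF F(1)] by blast
  define m where "m = card E"
  define g where "g = \<rho> / (4 * sqrt (real m))"
  \<comment> \<open>Cauchy-Schwarz contributes \<open>4 * m\<close> and the use of the floor at most 1 per coordinate.\<close>
  define Z where "Z = {z \<in> E \<rightarrow>\<^sub>E (UNIV :: int set). (\<Sum>e\<in>E. \<bar>z e\<bar>) \<le> int (5 * m)}"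
  define pt where "pt = (\<lambda>z::'a \<Rightarrow> int. \<Sum>e\<in>E. (g * of_int (z e)) *\<^sub>R e)"
  have Z: "finite Z" "real (card Z) \<le> 2 ^ (5 * m) * 3 ^ m"
    using card_lattice_points_le[OF E(1), of "5 * m"] by (simp_all add: Z_def m_def)
  show ?thesis
  proof (rule coverableI)
    show "finite (pt ` Z)" using Z by simp
    have "real (card (pt ` Z)) \<le> real (card Z)" using card_image_le[OF Z(1), of pt] by simp
    also have "\<dots> \<le> 96 ^ m" using Z(2) by (simp add: power_mult flip: power_mult_distrib)
    also have "\<dots> = exp (real m * ln 96)" by (simp add: exp_of_nat_mult)
    also have "\<dots> \<le> exp (d * ln 96)" using E F by (simp add: m_def)
    finally show "real (card (pt ` Z)) \<le> exp (d * ln 96)" .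
    fix u assume u: "u \<in> span F \<inter> cball 0 \<rho>"
    then have nu: "norm u \<le> \<rho>" by simp
    have exp_u: "u = (\<Sum>e\<in>E. inner u e *\<^sub>R e)"
      using proj_onto_fixes_span[OF E(1,3), of u] u E(4) by (simp add: proj_onto_def)
    define z where "z = (\<lambda>e\<in>E. \<lfloor>inner u e / g\<rfloor>)"
    have g: "g > 0" if "m > 0" using that \<rho> by (simp add: g_def)
    have gm: "m > 0 \<Longrightarrow> \<rho> / g = 4 * sqrt (real m)" using \<rho> by (simp add: g_def)
    have Em: "m > 0" if "e \<in> E" for e using that E(1) by (auto simp: m_def card_gt_0_iff)
    have "(\<Sum>e\<in>E. \<bar>z e\<bar>) \<le> int (5 * m)"
    proof (cases "m = 0")
      case True
      then show ?thesis using E(1) by (simp add: m_def)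
    next
      case False
      then have m: "m > 0" by simp
      have "real_of_int (\<Sum>e\<in>E. \<bar>z e\<bar>) \<le> (\<Sum>e\<in>E. \<bar>inner u e\<bar> / g + 1)"
      proof (simp only: of_int_sum, rule sum_mono)
        fix e assume "e \<in> E"
        have "\<bar>real_of_int \<lfloor>inner u e / g\<rfloor>\<bar> \<le> \<bar>inner u e / g\<bar> + 1" by linarith
        then show "real_of_int \<bar>z e\<bar> \<le> \<bar>inner u e\<bar> / g + 1"
          using \<open>e \<in> E\<close> g[OF m] by (simp add: z_def abs_divide)
      qed
      also have "\<dots> = (\<Sum>e\<in>E. \<bar>inner u e\<bar>) / g + real m"
        by (simp add: sum.distrib sum_divide_distrib m_def)
      also have "(\<Sum>e\<in>E. \<bar>inner u e\<bar>) \<le> L2_set (\<lambda>e. inner u e) E * L2_set (\<lambda>_. 1) E"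
        using L2_set_mult_ineq[of "\<lambda>e. inner u e" "\<lambda>_. 1" E] by simp
      also have "L2_set (\<lambda>e. inner u e) E = norm u"
        unfolding L2_set_def norm_orthonormal_sum[OF E(1,3), symmetric] using exp_u by simp
      also have "L2_set (\<lambda>_. 1) E = sqrt (real m)" by (simp add: L2_set_def m_def)
      also have "norm u * sqrt (real m) / g + real m \<le> \<rho> * sqrt (real m) / g + real m"
        using nu g[OF m] by (intro add_right_mono divide_right_mono mult_right_mono) auto
      also have "\<rho> * sqrt (real m) / g = \<rho> / g * sqrt (real m)" by simp
      also have "\<dots> = 4 * real m" by (simp add: gm[OF m])
      finally have "real_of_int (\<Sum>e\<in>E. \<bar>z e\<bar>) \<le> real_of_int (int (5 * m))" using g[OF m]
        by (simp add: divide_right_mono)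
      then show ?thesis by (simp only: of_int_le_iff)
    qed
    then have zZ: "z \<in> Z" by (simp add: Z_def z_def)
    have "u - pt z = (\<Sum>e\<in>E. (inner u e - g * of_int (z e)) *\<^sub>R e)"
      unfolding pt_def by (subst exp_u) (simp add: scaleR_diff_left sum_subtractf)
    then have "(norm (u - pt z))\<^sup>2 = (\<Sum>e\<in>E. (inner u e - g * of_int (z e))\<^sup>2)"
      by (simp only: norm_orthonormal_sum[OF E(1,3)])
    also have "\<dots> \<le> (\<Sum>e\<in>E. g\<^sup>2)"
    proof (rule sum_mono)
      fix e assume e: "e \<in> E"
      define t where "t = inner u e / g"
      have t: "inner u e = g * t" using g[OF Em[OF e]] by (simp add: t_def)
      have "inner u e - g * of_int (z e) = g * (t - of_int \<lfloor>t\<rfloor>)"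
        using e by (simp add: z_def t_def[symmetric] t algebra_simps)
      moreover have "\<bar>t - of_int \<lfloor>t\<rfloor>\<bar> \<le> 1" by linarith
      ultimately show "(inner u e - g * of_int (z e))\<^sup>2 \<le> g\<^sup>2"
        using mult_left_mono[of "\<bar>t - of_int \<lfloor>t\<rfloor>\<bar>" 1 "\<bar>g\<bar>"] by (simp add: abs_le_square_iff[symmetric] abs_mult)
    qed
    also have "\<dots> = real m * g\<^sup>2" by (simp add: m_def)
    also have "\<dots> \<le> (\<rho> / 4)\<^sup>2" by (simp add: g_def power_divide power_mult_distrib)
    finally have "norm (u - pt z) \<le> \<rho> / 4" using \<rho> by (simp add: power2_le_iff_abs_le)
    then show "\<exists>s\<in>pt ` Z. dist s u \<le> \<rho> / 4" using zZ by (auto simp: dist_norm norm_minus_commute)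
  qed
qed

text \<open>
  Each ball of the given cover meets \<open>T\<close> in a translate of a subset of the ball of radius \<open>2 * \<eta>\<close> in the
  span. The translation is by a point of \<open>T\<close>, because the centre of the ball may lie outside the span;
  this doubles the radius, hence the ratio 4 in \<open>coverable_ball_span\<close>.
\<close>
lemma coverable_halve:
  fixes F :: "'a::real_inner set"
  assumes F: "finite F" "real (card F) \<le> d" and T: "T \<subseteq> span F"
    and \<eta>: "\<eta> > 0" and cov: "coverable T \<eta> h"
  shows "coverable T (\<eta> / 2) (h + d * ln 96)"
proof -
  obtain S where S: "finite S" "real (card S) \<le> exp h" "\<And>x. x \<in> T \<Longrightarrow> \<exists>s\<in>S. dist s x \<le> \<eta>"
    using cov by (rule coverableE) blast
  obtain Q where Q: "finite Q" "real (card Q) \<le> exp (d * ln 96)"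
    "\<And>x. x \<in> span F \<inter> cball 0 (2 * \<eta>) \<Longrightarrow> \<exists>s\<in>Q. dist s x \<le> 2 * \<eta> / 4"
    using coverable_ball_span[OF F, of "2 * \<eta>"] \<eta> by (auto elim!: coverableE)
  define u where "u = (\<lambda>s. SOME x. x \<in> T \<and> dist s x \<le> \<eta>)"
  let ?S = "(\<lambda>(s, q). u s + q) ` (S \<times> Q)"
  show ?thesis
  proof (rule coverableI)
    show "finite ?S" using S Q by simp
    have "card ?S \<le> card S * card Q"
      using card_image_le[of "S \<times> Q" "\<lambda>(s, q). u s + q"] S Q by (simp add: card_cartesian_product)
    then have "real (card ?S) \<le> real (card S) * real (card Q)" by (simp flip: of_nat_mult)
    also have "\<dots> \<le> exp h * exp (d * ln 96)" using S Q by (intro mult_mono) auto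
    finally show "real (card ?S) \<le> exp (h + d * ln 96)" by (simp add: exp_add)
    fix x assume x: "x \<in> T"
    then obtain s where s: "s \<in> S" "dist s x \<le> \<eta>" using S(3) by blast
    then have u: "u s \<in> T" "dist s (u s) \<le> \<eta>"
      using someI[of "\<lambda>x. x \<in> T \<and> dist s x \<le> \<eta>" x] x by (simp_all add: u_def)
    have "norm (x - u s) \<le> 2 * \<eta>"
      using dist_triangle3[of x "u s" s] s u by (simp add: dist_norm)
    then have "x - u s \<in> span F \<inter> cball 0 (2 * \<eta>)"
      using x u T by (auto intro!: real_vector.span_diff)
    then obtain q where "q \<in> Q" "dist q (x - u s) \<le> 2 * \<eta> / 4" using Q(3) by blast
    then show "\<exists>s\<in>?S. dist s x \<le> \<eta> / 2"
      using s by (intro bexI[of _ "u s + q"]) (auto simp: dist_norm algebra_simps)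
  qed
qed

lemma coverable_halve_repeatedly:
  fixes F :: "'a::real_inner set"
  assumes F: "finite F" "real (card F) \<le> d" and T: "T \<subseteq> span F"
    and \<eta>: "\<eta> > 0" and cov: "coverable T \<eta> h"
  shows "coverable T (\<eta> / 2 ^ i) (h + real i * d * ln 96)"
proof (induction i)
  case 0
  then show ?case using cov by simp
next
  case (Suc i)
  have "coverable T (\<eta> / 2 ^ i / 2) (h + real i * d * ln 96 + d * ln 96)"
    by (rule coverable_halve[OF F T _ Suc.IH]) (use \<eta> in simp)
  then show ?case by (simp add: algebra_simps)
qed

section \<open>Chaining over all scales\<close>

text \<open>
  The number of halvings per scale: at scale \<open>k\<close> the radius has to shrink by the factor
  \<open>2 powr (k * (2 + W / 2))\<close>, of which \<open>k * (1 + W / 2)\<close> binary orders make up for the loss in the sparse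
  approximation and \<open>k\<close> orders make the radii summable.
\<close>
definition halvings :: "real \<Rightarrow> nat" where "halvings W = nat \<lceil>2 + W / 2\<rceil>"

text \<open>
  The total cost of the chaining in units of \<open>N\<close>. The leading 1 pays for the remainder \<open>x - a\<^sub>0\<close>; at scale
  \<open>k\<close> there is the cost of the sparse approximation and that of \<open>halvings W * k\<close> halvings in dimension
  \<open>2 N 2\<^bsup>-kW\<^esup>\<close>.
\<close>
definition chain_const :: "real \<Rightarrow> real" where
  "chain_const W = 1 + (\<Sum>k. (1 + 2 * real (halvings W * k) * ln 96) * 2 powr (- (real k * W)))"

lemma summable_chain_const:
  assumes "W > 0"
  shows "summable (\<lambda>k. (1 + 2 * real (halvings W * k) * ln 96) * 2 powr (- (real k * W)))"
proof -
  define q where "q = 2 powr (- W)"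
  have q: "0 < q" "q < 1" using assms powr_less_mono[of "-W" 0 2] by (simp_all add: q_def)
  have eq: "2 powr (- (real k * W)) = q ^ k" for k
    by (simp add: q_def powr_powr mult.commute flip: powr_realpow)
  have geo: "summable (\<lambda>k. q ^ k)" using q by (simp add: summable_geometric_iff)
  moreover have "summable (\<lambda>k. real k * q ^ k)"
  proof -
    have "summable (\<lambda>k. real (Suc k) * q ^ k)"
      using geometric_deriv_sums[of q] q by (auto simp: sums_iff)
    from summable_diff[OF this geo] show ?thesis by (simp add: algebra_simps)
  qed
  ultimately have "summable (\<lambda>k. q ^ k + (2 * real (halvings W) * ln 96) * (real k * q ^ k))"
    by (intro summable_add summable_mult)
  then show ?thesis unfolding eq by (simp add: algebra_simps)
qed

lemma chain_const_pos: "W > 0 \<Longrightarrow> chain_const W > 0"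
  unfolding chain_const_def
  by (intro add_pos_nonneg suminf_nonneg summable_chain_const) (auto intro!: mult_nonneg_nonneg)

lemma chain_const_bound:
  assumes "W > 0"
  shows "1 + (\<Sum>k<K. (1 + 2 * real (halvings W * k) * ln 96) * 2 powr (- (real k * W))) \<le> chain_const W"
  unfolding chain_const_def
  by (intro add_left_mono sum_le_suminf summable_chain_const assms) (auto intro!: mult_nonneg_nonneg)

text \<open>
  The cost \<open>r p L = N p\<close> of the sparse approximation at scale \<open>k\<close>, with \<open>p = 2\<^bsup>-kW\<^esup>\<close>, is
  chosen equal to the dimension bound, that is, comparable with the cost of one halving. At the finest
  scale \<open>k = 0\<close>, where the dimension is largest, the radius is then already the target \<open>\<rho>\<close> and no halving
  occurs; the number of halvings grows linearly in \<open>k\<close>, which the geometric decay of the dimensions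
  absorbs.
\<close>
proposition coverable_chaining:
  fixes x :: "'i \<Rightarrow> 'a::real_inner"
  assumes J: "finite J" and W: "W > 0" and N: "N > 0" and s: "s > 0"
    and L: "L > 0" "ln (2 * real (card (x ` J)) + 1) \<le> L"
    and approx: "\<And>k::nat. \<exists>F. finite F \<and> real (card F) \<le> N * 2 powr (- (real k * W)) \<and>
      (\<forall>j\<in>J. \<exists>a\<in>span F. norm (x j - a) \<le> s * 2 ^ k)"
  shows "coverable (abs_hull J x) (27 * s * sqrt (L / N)) (chain_const W * N)"
proof -
  \<comment> \<open>From the scale \<open>K\<close> on the zero subspace approximates all points, so the chain ends there. The bounds do
    not depend on \<open>K\<close>, since all sums are dominated by convergent series.\<close>
  obtain K where K: "\<And>j. j \<in> J \<Longrightarrow> norm (x j) \<le> s * 2 ^ K"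
  proof -
    obtain K where K: "(\<Sum>j\<in>J. norm (x j)) / s < 2 ^ K" using real_arch_pow[of 2] by auto
    have "norm (x j) \<le> s * 2 ^ K" if "j \<in> J" for j
      using member_le_sum[OF that, of "\<lambda>j. norm (x j)"] J K s by (simp add: field_simps)
    then show ?thesis using that by blast
  qed
  have "\<exists>F. finite F \<and> real (card F) \<le> N * 2 powr (- (real k * W)) \<and>
      (\<forall>j\<in>J. \<exists>a\<in>span F. norm (x j - a) \<le> s * 2 ^ k) \<and> (k = K \<longrightarrow> F = {})" for k
  proof (cases "k = K")
    case True
    then show ?thesis using K N by (intro exI[of _ "{}"]) simp
  next
    case False
    then show ?thesis using approx[of k] by simp
  qed
  then obtain F where F: "\<And>k. finite (F k)" "\<And>k. real (card (F k)) \<le> N * 2 powr (- (real k * W))"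
    "\<And>k. \<forall>j\<in>J. \<exists>a\<in>span (F k). norm (x j - a) \<le> s * 2 ^ k" "F K = {}"
    by metis
  \<comment> \<open>The approximants depend on the point and not on its index, so that passing to them does not increase
    the number of distinct generators.\<close>
  define a where "a = (\<lambda>k v. SOME u. u \<in> span (F k) \<and> norm (v - u) \<le> s * 2 ^ k)"
  have a: "a k (x j) \<in> span (F k)" "norm (x j - a k (x j)) \<le> s * 2 ^ k" if "j \<in> J" for k j
    using someI_ex[of "\<lambda>u. u \<in> span (F k) \<and> norm (x j - u) \<le> s * 2 ^ k"] F(3)[of k] that
    by (auto simp: a_def)
  have aK: "a K (x j) = 0" if "j \<in> J" for j using a(1)[OF that, of K] F(4) by simp
  \<comment> \<open>Link 0 of the chain is the remainder, link \<open>k + 1\<close> is \<open>a k v - a (k + 1) v\<close>.\<close>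
  define g where "g = (\<lambda>k v. if k = 0 then v - a 0 v else a (k - 1) v - a k v)"
  have card_g: "ln (2 * real (card ((\<lambda>j. g k (x j)) ` J)) + 1) \<le> L" for k
  proof -
    have "card ((\<lambda>j. g k (x j)) ` J) \<le> card (x ` J)"
      using card_image_le[of "x ` J" "g k"] J by (simp add: image_image)
    then have "ln (2 * real (card ((\<lambda>j. g k (x j)) ` J)) + 1) \<le> ln (2 * real (card (x ` J)) + 1)"
      by (intro ln_mono) auto
    with L show ?thesis by linarith
  qed
  define r where "r = N / L"
  have r: "r > 0" using N L by (simp add: r_def)
  \<comment> \<open>The factor 9 is \<open>3 * 3\<close>: the links have norm at most \<open>3 * s * 2 ^ k\<close>, and sparse approximation has
    the constant 3. The remainder contributes at most \<open>\<rho>\<close> and the other links at most \<open>2 * \<rho>\<close>.\<close>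
  define \<rho> where "\<rho> = 9 * s * sqrt (L / N)"
  have \<rho>: "\<rho> > 0" using s N L by (simp add: \<rho>_def)
  have \<rho>r: "\<rho> = 9 * s / sqrt r" by (simp add: \<rho>_def r_def real_sqrt_divide)
  define R where "R = (\<lambda>k. if k = 0 then \<rho> else \<rho> / 2 ^ (k - 1))"
  define h where "h = (\<lambda>k. if k = 0 then N else
    N * ((1 + 2 * real (halvings W * (k - 1)) * ln 96) * 2 powr (- (real (k - 1) * W))))"
  have cov: "coverable (abs_hull J (\<lambda>j. g k (x j))) (R k) (h k)" for k
  proof (cases k)
    case 0
    have "coverable (abs_hull J (\<lambda>j. g k (x j))) (3 * s / sqrt r) (r * L)"
      by (rule coverable_abs_hull[OF J _ _ r card_g]) (use 0 a(2)[of _ 0] s in \<open>simp_all add: g_def\<close>)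
    moreover have "r * L = h k" using L 0 by (simp add: r_def h_def)
    moreover have "3 * s / sqrt r \<le> R k"
      using 0 s r by (simp add: R_def \<rho>r divide_right_mono)
    ultimately show ?thesis using coverable_mono[OF _ subset_refl] by (metis order_refl)
  next
    case (Suc l)
    define p where "p = 2 powr (- (real l * W))"
    have p: "p > 0" by (simp add: p_def)
    have g: "g k v = a l v - a (Suc l) v" for v by (simp add: g_def Suc)
    \<comment> \<open>Two consecutive approximation errors add up to \<open>s * 2 ^ l + s * 2 ^ (l + 1)\<close>.\<close>
    have bound: "norm (g k (x j)) \<le> 3 * (s * 2 ^ l)" if "j \<in> J" for j
    proof -
      have "g k (x j) = (x j - a (Suc l) (x j)) - (x j - a l (x j))" by (simp add: g)
      then show ?thesis
        using norm_triangle_ineq4[of "x j - a (Suc l) (x j)" "x j - a l (x j)"]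
          a(2)[OF that, of l] a(2)[OF that, of "Suc l"] by simp
    qed
    have c1: "coverable (abs_hull J (\<lambda>j. g k (x j))) (3 * (3 * (s * 2 ^ l)) / sqrt (r * p)) ((r * p) * L)"
      by (rule coverable_abs_hull[OF J bound _ _ card_g]) (use s r p in simp_all)
    have sub: "abs_hull J (\<lambda>j. g k (x j)) \<subseteq> span (F l \<union> F (Suc l))"
    proof (rule abs_hull_subset_span)
      fix j assume j: "j \<in> J"
      have "a l (x j) \<in> span (F l \<union> F (Suc l))"
        "a (Suc l) (x j) \<in> span (F l \<union> F (Suc l))"
        using a(1)[OF j, of l] a(1)[OF j, of "Suc l"]
          real_vector.span_mono[of "F l" "F l \<union> F (Suc l)"]
          real_vector.span_mono[of "F (Suc l)" "F l \<union> F (Suc l)"] by auto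
      then show "g k (x j) \<in> span (F l \<union> F (Suc l))"
        unfolding g by (rule real_vector.span_diff)
    qed
    have "real (card (F l \<union> F (Suc l))) \<le> real (card (F l)) + real (card (F (Suc l)))"
      using card_Un_le[of "F l" "F (Suc l)"] by (simp flip: of_nat_add)
    also have "real (card (F (Suc l))) \<le> N * p"
    proof -
      have "2 powr (- (real (Suc l) * W)) \<le> p"
        unfolding p_def using W by (intro powr_mono) (auto simp: algebra_simps)
      then show ?thesis using F(2)[of "Suc l"] N by (meson mult_left_mono less_imp_le order_trans)
    qed
    also have "real (card (F l)) \<le> N * p" using F(2)[of l] by (simp add: p_def)
    finally have cd: "real (card (F l \<union> F (Suc l))) \<le> 2 * N * p" by simp
    have c2: "coverable (abs_hull J (\<lambda>j. g k (x j)))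
      (3 * (3 * (s * 2 ^ l)) / sqrt (r * p) / 2 ^ (halvings W * l))
      ((r * p) * L + real (halvings W * l) * (2 * N * p) * ln 96)"
      by (rule coverable_halve_repeatedly[OF _ cd sub _ c1]) (use F s r p in auto)
    have "(r * p) * L + real (halvings W * l) * (2 * N * p) * ln 96 = h k"
      using L by (simp add: Suc h_def r_def p_def algebra_simps)
    moreover have "3 * (3 * (s * 2 ^ l)) / sqrt (r * p) / 2 ^ (halvings W * l) \<le> R k"
    proof -
      have hW: "2 + W / 2 \<le> real (halvings W)" unfolding halvings_def by linarith
      have sp: "sqrt p = 2 powr (- (real l * W / 2))"
        by (simp add: p_def powr_half_sqrt[symmetric] powr_powr)
      have "2 ^ l * 2 ^ l * 2 powr (real l * W / 2) = 2 powr (real l * (2 + W / 2))"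
        by (simp add: powr_realpow[symmetric] powr_add[symmetric] algebra_simps)
      also have "\<dots> \<le> 2 powr (real (halvings W * l))"
        using hW by (intro powr_mono) (auto simp: mult.commute intro!: mult_left_mono)
      also have "\<dots> = 2 ^ (halvings W * l)" by (rule powr_realpow) simp
      finally have "2 ^ l * 2 ^ l / sqrt p \<le> 2 ^ (halvings W * l)"
        by (simp add: sp powr_minus_divide)
      then have "2 ^ l / sqrt p / 2 ^ (halvings W * l) \<le> 1 / 2 ^ l"
        using p by (simp add: pos_divide_le_eq pos_le_divide_eq mult_ac)
      then have "\<rho> * (2 ^ l / sqrt p / 2 ^ (halvings W * l)) \<le> \<rho> * (1 / 2 ^ l)"
        using \<rho> by (intro mult_left_mono) auto
      then show ?thesis by (simp add: Suc R_def \<rho>r real_sqrt_mult mult_ac)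
    qed
    ultimately show ?thesis using coverable_mono[OF c2 subset_refl] by simp
  qed
  have telescope: "(\<Sum>k<Suc K. g k (x j)) = x j" if "j \<in> J" for j
  proof -
    have "(\<Sum>k<Suc M. g k (x j)) = x j - a M (x j)" for M
      by (induction M) (simp_all add: g_def)
    then show ?thesis using aK[OF that] by simp
  qed
  have "abs_hull J x = abs_hull J (\<lambda>j. \<Sum>k<Suc K. g k (x j))"
    unfolding abs_hull_def using telescope by (simp cong: sum.cong)
  then have sub: "abs_hull J x \<subseteq> {\<Sum>k<Suc K. z k | z. \<forall>k<Suc K. z k \<in> abs_hull J (\<lambda>j. g k (x j))}"
    using abs_hull_sum_subset[where K = "Suc K" and y = "\<lambda>k j. g k (x j)" and J = J] by simp
  have "(\<Sum>k<Suc K. R k) = \<rho> + \<rho> * (\<Sum>k<K. (1/2) ^ k)"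
    by (simp add: R_def sum.lessThan_Suc_shift sum_distrib_left power_divide del: sum.lessThan_Suc)
  also have "(\<Sum>k<K. (1/2::real) ^ k) \<le> 2" by (simp add: geometric_sum)
  finally have "(\<Sum>k<Suc K. R k) \<le> \<rho> + \<rho> * 2" using \<rho> by simp
  then have Rs: "(\<Sum>k<Suc K. R k) \<le> 27 * s * sqrt (L / N)" by (simp add: \<rho>_def)
  have "(\<Sum>k<Suc K. h k) = N * (1 + (\<Sum>k<K. (1 + 2 * real (halvings W * k) * ln 96) * 2 powr (- (real k * W))))"
    by (simp add: h_def sum.lessThan_Suc_shift sum_distrib_left distrib_left del: sum.lessThan_Suc of_nat_mult)
  also have "\<dots> \<le> N * chain_const W" using chain_const_bound[OF W] N by (intro mult_left_mono) auto
  finally have hs: "(\<Sum>k<Suc K. h k) \<le> chain_const W * N" by (simp add: mult.commute)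
  show ?thesis by (rule coverable_mono[OF coverable_sum[OF cov] sub Rs hs])
qed

section \<open>Finitely supported sequences\<close>

typedef fsvec = "{f :: nat \<Rightarrow> real. finite {i. f i \<noteq> 0}}"
  morphisms coord Fsvec
  by (rule exI[of _ "\<lambda>_. 0"]) simp

setup_lifting type_definition_fsvec

lemma finite_coord: "finite {i. coord x i \<noteq> 0}"
  using coord[of x] by simp

lemma finite_coord_mult: "finite {i. coord x i * coord y i \<noteq> 0}"
  by (rule finite_subset[OF _ finite_coord[of x]]) auto

instantiation fsvec :: real_vector
begin

lift_definition zero_fsvec :: fsvec is "\<lambda>_. 0" by simp
lift_definition plus_fsvec :: "fsvec \<Rightarrow> fsvec \<Rightarrow> fsvec" is "\<lambda>f g i. f i + g i"
  subgoal for f g by (rule finite_subset[of _ "{i. f i \<noteq> 0} \<union> {i. g i \<noteq> 0}"]) auto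
  done
lift_definition uminus_fsvec :: "fsvec \<Rightarrow> fsvec" is "\<lambda>f i. - f i" by simp
lift_definition minus_fsvec :: "fsvec \<Rightarrow> fsvec \<Rightarrow> fsvec" is "\<lambda>f g i. f i - g i"
  subgoal for f g by (rule finite_subset[of _ "{i. f i \<noteq> 0} \<union> {i. g i \<noteq> 0}"]) auto
  done
lift_definition scaleR_fsvec :: "real \<Rightarrow> fsvec \<Rightarrow> fsvec" is "\<lambda>c f i. c * f i"
  subgoal for c f by (rule finite_subset[of _ "{i. f i \<noteq> 0}"]) auto
  done

instance
proof
  fix x y z :: fsvec and a b :: real
  show "x + y + z = x + (y + z)" "x + y = y + x" "0 + x = x" "- x + x = 0" "x - y = x + - y"
    by (transfer; simp add: fun_eq_iff)+
  show "a *\<^sub>R (x + y) = a *\<^sub>R x + a *\<^sub>R y" "(a + b) *\<^sub>R x = a *\<^sub>R x + b *\<^sub>R x"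
    "a *\<^sub>R b *\<^sub>R x = (a * b) *\<^sub>R x" "1 *\<^sub>R x = x"
    by (transfer; simp add: fun_eq_iff algebra_simps)+
qed

end

instantiation fsvec :: real_inner
begin

definition inner_fsvec :: "fsvec \<Rightarrow> fsvec \<Rightarrow> real" where
  "inner_fsvec x y = (\<Sum>i. coord x i * coord y i)"
definition norm_fsvec :: "fsvec \<Rightarrow> real" where
  "norm_fsvec x = sqrt (inner x x)"
definition dist_fsvec :: "fsvec \<Rightarrow> fsvec \<Rightarrow> real" where
  "dist_fsvec x y = norm (x - y)"
definition sgn_fsvec :: "fsvec \<Rightarrow> fsvec" where
  "sgn_fsvec x = x /\<^sub>R norm x"
definition uniformity_fsvec :: "(fsvec \<times> fsvec) filter" where
  "uniformity_fsvec = (INF e\<in>{0<..}. principal {(x, y). dist x y < e})"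
definition open_fsvec :: "fsvec set \<Rightarrow> bool" where
  "open_fsvec U = (\<forall>x\<in>U. \<forall>\<^sub>F (x', y) in uniformity. x' = x \<longrightarrow> y \<in> U)"

lemma summable_coord_mult: "summable (\<lambda>i. coord x i * coord y i)"
  by (rule summable_finite[OF finite_coord_mult]) auto

instance
proof
  fix x y z :: fsvec and a b :: real
  show "dist x y = norm (x - y)" by (simp add: dist_fsvec_def)
  show "sgn x = x /\<^sub>R norm x" by (simp add: sgn_fsvec_def)
  show "uniformity = (INF e\<in>{0<..}. principal {(x :: fsvec, y). dist x y < e})"
    by (simp add: uniformity_fsvec_def)
  show "open U = (\<forall>x\<in>U. \<forall>\<^sub>F (x', y) in uniformity. x' = x \<longrightarrow> y \<in> U)" for U :: "fsvec set"
    by (simp add: open_fsvec_def)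
  show "inner x y = inner y x" by (simp add: inner_fsvec_def mult.commute)
  show "inner (x + y) z = inner x z + inner y z"
    by (simp add: inner_fsvec_def plus_fsvec.rep_eq suminf_add summable_coord_mult distrib_right)
  show "inner (a *\<^sub>R x) y = a * inner x y"
    by (simp add: inner_fsvec_def scaleR_fsvec.rep_eq suminf_mult summable_coord_mult mult.assoc)
  show "0 \<le> inner x x"
    unfolding inner_fsvec_def by (rule suminf_nonneg[OF summable_coord_mult]) simp
  show "inner x x = 0 \<longleftrightarrow> x = 0"
    unfolding inner_fsvec_def
    by (subst suminf_eq_zero_iff[OF summable_coord_mult]) (simp_all, transfer, auto)
  show "norm x = sqrt (inner x x)" by (simp add: norm_fsvec_def)
qed

end

text \<open>
  The isometric embedding of \<open>carrier_vec n\<close> by padding with zeros; \<open>to_vec n\<close> is truncation, a left inverse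
  that does not increase norms and can therefore be used to bring the centres of a cover back into
  \<open>carrier_vec n\<close>.
\<close>
definition of_vec :: "real vec \<Rightarrow> fsvec" where
  "of_vec v = Fsvec (\<lambda>i. if i < dim_vec v then v $ i else 0)"

definition to_vec :: "nat \<Rightarrow> fsvec \<Rightarrow> real vec" where
  "to_vec n x = vec n (coord x)"

lemma coord_of_vec: "coord (of_vec v) i = (if i < dim_vec v then v $ i else 0)"
proof -
  have "finite {i. (if i < dim_vec v then v $ i else 0) \<noteq> 0}"
    by (rule finite_subset[of _ "{..<dim_vec v}"]) auto
  then show ?thesis unfolding of_vec_def by (simp add: Fsvec_inverse)
qed

lemma fsvec_eqI: "(\<And>i. coord x i = coord y i) \<Longrightarrow> x = y"
  by (metis coord_inject ext)

lemma to_vec_carrier [simp]: "to_vec n x \<in> carrier_vec n"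
  by (simp add: to_vec_def)

lemma to_vec_of_vec [simp]: "v \<in> carrier_vec n \<Longrightarrow> to_vec n (of_vec v) = v"
  by (intro eq_vecI) (auto simp: to_vec_def coord_of_vec)

lemma of_vec_add: "u \<in> carrier_vec n \<Longrightarrow> v \<in> carrier_vec n \<Longrightarrow> of_vec (u + v) = of_vec u + of_vec v"
  by (rule fsvec_eqI) (auto simp: coord_of_vec plus_fsvec.rep_eq)

lemma of_vec_minus: "u \<in> carrier_vec n \<Longrightarrow> v \<in> carrier_vec n \<Longrightarrow> of_vec (u - v) = of_vec u - of_vec v"
  by (rule fsvec_eqI) (auto simp: coord_of_vec minus_fsvec.rep_eq)

lemma of_vec_smult: "of_vec (c \<cdot>\<^sub>v v) = c *\<^sub>R of_vec v"
  by (rule fsvec_eqI) (auto simp: coord_of_vec scaleR_fsvec.rep_eq)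

lemma of_vec_zero: "of_vec (0\<^sub>v n) = 0"
  by (rule fsvec_eqI) (auto simp: coord_of_vec zero_fsvec.rep_eq)

lemma inner_of_vec:
  assumes "u \<in> carrier_vec n" "v \<in> carrier_vec n"
  shows "inner (of_vec u) (of_vec v) = u \<bullet> v"
proof -
  have "inner (of_vec u) (of_vec v) = (\<Sum>i<n. coord (of_vec u) i * coord (of_vec v) i)"
    unfolding inner_fsvec_def using assms by (intro suminf_finite) (auto simp: coord_of_vec)
  also have "\<dots> = u \<bullet> v"
    using assms by (auto simp: scalar_prod_def coord_of_vec atLeast0LessThan intro!: sum.cong)
  finally show ?thesis .
qed

lemma norm_of_vec: "norm (of_vec v) = l2_norm v"
proof -
  have "v \<bullet> v = (\<Sum>i<dim_vec v. (v $ i)\<^sup>2)"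
    by (simp add: scalar_prod_def atLeast0LessThan power2_eq_square)
  moreover have "inner (of_vec v) (of_vec v) = v \<bullet> v" by (rule inner_of_vec[of _ "dim_vec v"]) auto
  ultimately show ?thesis
    by (simp only: norm_fsvec_def l2_norm_def L2_set_def)
qed

lemma l2_norm_to_vec_le: "l2_norm (to_vec n x) \<le> norm x"
proof -
  have "(\<Sum>i<n. (coord x i)\<^sup>2) \<le> inner x x"
    unfolding inner_fsvec_def power2_eq_square by (rule sum_le_suminf[OF summable_coord_mult]) auto
  moreover have "l2_norm (to_vec n x) = sqrt (\<Sum>i<n. (coord x i)\<^sup>2)"
    by (simp add: l2_norm_def L2_set_def to_vec_def)
  ultimately show ?thesis by (simp only: norm_fsvec_def real_sqrt_le_iff)
qed

lemma to_vec_minus: "to_vec n (x - y) = to_vec n x - to_vec n y"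
  by (intro eq_vecI) (auto simp: to_vec_def minus_fsvec.rep_eq)

lemma to_vec_add: "to_vec n (x + y) = to_vec n x + to_vec n y"
  by (intro eq_vecI) (auto simp: to_vec_def plus_fsvec.rep_eq)

lemma to_vec_scaleR: "to_vec n (c *\<^sub>R x) = c \<cdot>\<^sub>v to_vec n x"
  by (intro eq_vecI) (auto simp: to_vec_def scaleR_fsvec.rep_eq)

lemma to_vec_zero: "to_vec n 0 = 0\<^sub>v n"
  by (intro eq_vecI) (auto simp: to_vec_def zero_fsvec.rep_eq)

lemma l2_dist_of_vec:
  assumes "u \<in> carrier_vec n" "v \<in> carrier_vec n"
  shows "l2_dist u v = dist (of_vec u) (of_vec v)"
  using assms by (simp add: l2_dist_def dist_norm norm_of_vec flip: of_vec_minus)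

section \<open>Linear subspaces and orthogonal projection\<close>

lemma vec_subspaceD:
  assumes "VectorSpace.subspace class_ring U (module_vec TYPE(real) n)"
  shows "U \<subseteq> carrier_vec n" "0\<^sub>v n \<in> U" "\<And>u v. u \<in> U \<Longrightarrow> v \<in> U \<Longrightarrow> u + v \<in> U"
    "\<And>c u. u \<in> U \<Longrightarrow> c \<cdot>\<^sub>v u \<in> U"
proof -
  have sm: "submodule class_ring U (module_vec TYPE(real) n)"
    using assms by (simp add: VectorSpace.subspace_def)
  show "U \<subseteq> carrier_vec n" "0\<^sub>v n \<in> U"
    using submodule.subset[OF sm] submodule.zero_closed[OF sm] by (simp_all add: module_vec_simps)
  show "u + v \<in> U" if "u \<in> U" "v \<in> U" for u v
    using submodule.m_closed[OF sm that] by (simp add: module_vec_simps)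
  show "c \<cdot>\<^sub>v u \<in> U" if "u \<in> U" for c u
    using submodule.smult_closed[OF sm _ that, of c] by (simp add: module_vec_simps class_ring_simps)
qed

lemma vec_subspaceI:
  assumes "U \<subseteq> carrier_vec n" "0\<^sub>v n \<in> U" "\<And>u v. u \<in> U \<Longrightarrow> v \<in> U \<Longrightarrow> u + v \<in> U"
    "\<And>c u. u \<in> U \<Longrightarrow> c \<cdot>\<^sub>v u \<in> U"
  shows "VectorSpace.subspace class_ring U (module_vec TYPE(real) n)"
proof (rule VectorSpace.subspace.intro)
  show vs: "vectorspace class_ring (module_vec TYPE(real) n)" by (rule vec_vs)
  show "submodule class_ring U (module_vec TYPE(real) n)"
    by (rule submodule.intro[OF vectorspace.axioms(1)[OF vs]])
      (simp_all add: module_vec_simps class_ring_simps assms)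
qed

lemma subspace_of_vec_image:
  assumes "VectorSpace.subspace class_ring U (module_vec TYPE(real) n)"
  shows "Real_Vector_Spaces.subspace (of_vec ` U)"
proof -
  note U = vec_subspaceD[OF assms]
  show ?thesis
  proof (rule real_vector.subspaceI)
    show "0 \<in> of_vec ` U" using U(2) of_vec_zero[of n] by force
    show "x + y \<in> of_vec ` U" if xy: "x \<in> of_vec ` U" "y \<in> of_vec ` U" for x y
    proof -
      obtain u v where uv: "u \<in> U" "v \<in> U" "x = of_vec u" "y = of_vec v" using xy by blast
      then have "u \<in> carrier_vec n" "v \<in> carrier_vec n" using U(1) by blast+
      then have "x + y = of_vec (u + v)" by (simp add: uv of_vec_add[of _ n])
      then show ?thesis using U(3) uv by blast
    qed
    show "c *\<^sub>R x \<in> of_vec ` U" if x: "x \<in> of_vec ` U" for c x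
    proof -
      obtain u where u: "u \<in> U" "x = of_vec u" using x by blast
      then have "c *\<^sub>R x = of_vec (c \<cdot>\<^sub>v u)" by (simp only: of_vec_smult)
      then show ?thesis using U(4) u(1) by blast
    qed
  qed
qed

lemma subspace_to_vec_vimage:
  assumes "VectorSpace.subspace class_ring U (module_vec TYPE(real) n)"
  shows "Real_Vector_Spaces.subspace {x. to_vec n x \<in> U}"
  by (rule real_vector.subspaceI)
    (use vec_subspaceD[OF assms] in \<open>auto simp: to_vec_zero to_vec_add to_vec_scaleR\<close>)

text \<open>
  The dimension in \<open>subspaces_of_dim\<close> is the least cardinality of a finite generating set, and it says
  nothing unless such a set exists. Existence is obtained from a basis of the embedded subspace, which
  is finite because it is independent in the span of the \<open>n\<close> unit vectors.
\<close>
lemma vec_subspace_generators: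
  assumes "U \<in> subspaces_of_dim n N"
  shows "\<exists>F. finite F \<and> card F \<le> N \<and> of_vec ` U = span F"
proof -
  interpret V: vec_space "TYPE(real)" n .
  have sub: "VectorSpace.subspace class_ring U V.V"
    and dim: "vectorspace.dim class_ring (V.vs U) = N"
    using assms unfolding subspaces_of_dim_def mem_Collect_eq by blast+
  note U = vec_subspaceD[OF sub]
  have subm: "submodule class_ring U V.V" using sub by (simp add: VectorSpace.subspace_def)
  interpret W: vectorspace class_ring "V.vs U" by (rule V.subspace_is_vs[OF sub])
  have span_eq: "W.span S = V.span S" if "S \<subseteq> U" for S
    using V.span_li_not_depend(1)[OF that subm] .
  obtain B where B: "B \<subseteq> of_vec ` U" "independent B" "of_vec ` U \<subseteq> span B"
    using real_vector.basis_exists[of "of_vec ` U"] by metis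
  let ?E = "of_vec ` set (unit_vecs n)"
  have unit_span: "of_vec v \<in> span ?E" if "v \<in> carrier_vec n" for v
  proof -
    let ?P = "{v \<in> carrier_vec n. of_vec v \<in> span ?E}"
    have "VectorSpace.subspace class_ring ?P V.V"
      by (rule vec_subspaceI)
        (auto simp: of_vec_zero of_vec_add of_vec_smult real_vector.span_zero
          intro: real_vector.span_add real_vector.span_scale)
    then have "V.span (set (unit_vecs n)) \<subseteq> ?P"
      using unit_vecs_carrier
      by (intro V.span_is_subset) (auto simp: VectorSpace.subspace_def intro: real_vector.span_base)
    then show ?thesis using that by (auto simp: V.span_unit_vecs_is_carrier)
  qed
  have "finite B"
  proof (rule conjunct1[OF real_vector.independent_span_bound[OF _ B(2)]])
    show "finite ?E" by simp
    show "B \<subseteq> span ?E" using B(1) U(1) unit_span by auto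
  qed
  let ?B = "to_vec n ` B"
  have BU: "?B \<subseteq> U"
    using B(1) U(1) by (auto simp: subset_iff image_iff)
  have "W.fin_dim"
    unfolding W.fin_dim_def
  proof (intro exI[of _ ?B] conjI)
    show "finite ?B" using \<open>finite B\<close> by simp
    show "?B \<subseteq> carrier (V.vs U)" using BU by simp
    have spB: "VectorSpace.subspace class_ring (V.span ?B) V.V"
      using BU U(1) by (intro V.span_is_subspace) auto
    have "span B \<subseteq> {x. to_vec n x \<in> V.span ?B}"
    proof (rule real_vector.span_minimal[OF _ subspace_to_vec_vimage[OF spB]])
      have "?B \<subseteq> V.span ?B" using BU U(1) by (intro V.in_own_span) auto
      then show "B \<subseteq> {x. to_vec n x \<in> V.span ?B}" by auto
    qed
    have "U \<subseteq> V.span ?B"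
    proof
      fix u assume u: "u \<in> U"
      then have "to_vec n (of_vec u) \<in> V.span ?B"
        using B(3) \<open>span B \<subseteq> {x. to_vec n x \<in> V.span ?B}\<close> by blast
      moreover have "u \<in> carrier_vec n" using u U(1) by blast
      ultimately show "u \<in> V.span ?B" by simp
    qed
    moreover have "V.span ?B \<subseteq> U" by (rule V.span_is_subset[OF BU subm])
    ultimately show "W.gen_set ?B" using span_eq[OF BU] by simp
  qed
  then have "\<exists>m A. finite A \<and> card A = m \<and> A \<subseteq> carrier (V.vs U) \<and> W.gen_set A"
    unfolding W.fin_dim_def by blast
  from LeastI_ex[OF this] have "\<exists>A. finite A \<and> card A = N \<and> A \<subseteq> carrier (V.vs U) \<and> W.gen_set A"
    unfolding W.dim_def[symmetric] dim .
  then obtain A where A: "finite A" "card A = N" "A \<subseteq> U" "W.span A = U" by auto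
  have "of_vec ` U = span (of_vec ` A)"
  proof
    let ?P = "{v \<in> carrier_vec n. of_vec v \<in> span (of_vec ` A)}"
    have "VectorSpace.subspace class_ring ?P V.V"
      by (rule vec_subspaceI)
        (auto simp: of_vec_zero of_vec_add of_vec_smult real_vector.span_zero
          intro: real_vector.span_add real_vector.span_scale)
    then have "V.span A \<subseteq> ?P"
      using A(3) U(1)
      by (intro V.span_is_subset) (auto simp: VectorSpace.subspace_def intro: real_vector.span_base)
    then show "of_vec ` U \<subseteq> span (of_vec ` A)"
      using A span_eq[OF A(3)] by auto
    show "span (of_vec ` A) \<subseteq> of_vec ` U"
      by (rule real_vector.span_minimal[OF _ subspace_of_vec_image[OF sub]]) (use A in auto)
  qed
  then show ?thesis using A(1,2) card_image_le[OF A(1), of of_vec] by (intro exI[of _ "of_vec ` A"]) auto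
qed

lemma subspaces_of_dim_nonempty:
  assumes "N \<le> n"
  shows "subspaces_of_dim n N \<noteq> {}"
proof -
  interpret V: vec_space "TYPE(real)" n .
  let ?E = "set (unit_vecs n) :: real vec set"
  have "card ?E = n"
    by (simp only: distinct_card[OF V.unit_vecs_distinct] V.unit_vecs_length)
  then have "N \<le> card ?E" by (simp only: assms)
  then obtain B where B: "B \<subseteq> ?E" "card B = N" "finite B"
    by (rule obtain_subset_with_card_n)
  have Bc: "B \<subseteq> carrier_vec n" using B(1) unit_vecs_carrier by (rule subset_trans)
  have "V.lin_indpt ?E" using V.unit_vecs_basis unfolding V.basis_def by (rule conjunct1)
  then have li: "V.lin_indpt B" using B(1) by (rule V.subset_li_is_li)
  let ?U = "V.span B"
  have sub: "VectorSpace.subspace class_ring ?U V.V" using Bc by (intro V.span_is_subspace) simp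
  then have subm: "submodule class_ring ?U V.V" by (simp add: VectorSpace.subspace_def)
  have BU: "B \<subseteq> ?U" using Bc by (intro V.in_own_span) simp
  interpret W: vectorspace class_ring "V.vs ?U" by (rule V.subspace_is_vs[OF sub])
  have "W.basis B"
    unfolding W.basis_def
    by (simp only: V.span_li_not_depend[OF BU subm] V.carrier_vs_is_self li BU simp_thms)
  from W.dim_basis[OF B(3) this] B(2) have "W.dim = N" by (rule trans)
  then have "?U \<in> subspaces_of_dim n N"
    unfolding subspaces_of_dim_def using sub by (intro CollectI conjI)
  then show ?thesis by blast
qed

text \<open>
  If \<open>u\<close> is the orthogonal projection of \<open>x\<close> onto \<open>U\<close>, then \<open>x - u\<close> satisfies the description of the
  projection onto the orthogonal complement, as \<open>U\<close> is contained in its double complement. It is the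
  only such vector: two of them differ by a vector that lies both in the complement of \<open>U\<close> and in the
  double complement and is thus orthogonal to itself.
\<close>
lemma orth_proj_orth_compl:
  assumes U: "U \<in> subspaces_of_dim n N" and x: "x \<in> carrier_vec n"
  shows "\<exists>u\<in>U. orth_proj n (orth_compl n U) x = x - u"
proof -
  have sub: "VectorSpace.subspace class_ring U (module_vec TYPE(real) n)"
    using U by (simp add: subspaces_of_dim_def)
  note Ud = vec_subspaceD[OF sub]
  interpret V: vec_space "TYPE(real)" n .
  obtain F where F: "finite F" "of_vec ` U = span F"
    using vec_subspace_generators[OF U] by blast
  obtain E where E: "finite E" "orthonormal E" "span E = of_vec ` U"
    using orthonormal_span_exists[OF F(1)] F(2) by metis
  obtain u where u: "u \<in> U" "proj_onto E (of_vec x) = of_vec u"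
    using proj_onto_in_span[of E "of_vec x"] E(3) by auto
  have uc: "u \<in> carrier_vec n" using u(1) Ud(1) by blast
  have orth: "(x - u) \<bullet> v = 0" if "v \<in> U" for v
  proof -
    have v: "v \<in> carrier_vec n" using that Ud(1) by blast
    have "inner (of_vec x - of_vec u) (of_vec v) = 0"
      using inner_residual_span[OF E(1,2), of "of_vec v" "of_vec x"] u(2) E(3) that by simp
    then show ?thesis using inner_of_vec[of "x - u" n v] x uc v by (simp add: of_vec_minus[of _ n])
  qed
  let ?y = "x - u"
  have y: "?y \<in> orth_compl n U" using orth x uc by (simp add: V.orthogonal_complement_def)
  have "orth_proj n (orth_compl n U) x = ?y"
    unfolding orth_proj_def
  proof (rule the_equality)
    have "x - ?y = u" using x uc by auto
    moreover have "u \<in> orth_compl n (orth_compl n U)"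
      using u(1) uc Ud(1) by (auto simp: V.orthogonal_complement_def comm_scalar_prod[of u n])
    ultimately show "?y \<in> orth_compl n U \<and> x - ?y \<in> orth_compl n (orth_compl n U)"
      using y by (simp only: simp_thms)
    fix y' assume y': "y' \<in> orth_compl n U \<and> x - y' \<in> orth_compl n (orth_compl n U)"
    have y'c: "y' \<in> carrier_vec n" using y' by (simp add: V.orthogonal_complement_def)
    have d: "y' - ?y \<in> orth_compl n U"
      using y y' by (auto simp: V.orthogonal_complement_def minus_scalar_prod_distrib[of _ n] subsetD[OF Ud(1)])
    then have d0: "(x - y') \<bullet> (y' - ?y) = 0" "u \<bullet> (y' - ?y) = 0"
      using y' \<open>u \<in> orth_compl n (orth_compl n U)\<close> by (auto simp: V.orthogonal_complement_def)
    have "inner (of_vec u - of_vec (x - y')) (of_vec (y' - ?y)) = 0"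
      using d0 inner_of_vec[of u n "y' - ?y"] inner_of_vec[of "x - y'" n "y' - ?y"] x uc y'c
      by (simp add: inner_diff_left)
    moreover have "of_vec u - of_vec (x - y') = of_vec (y' - ?y)"
      using x uc y'c by (simp add: of_vec_minus[of _ n])
    ultimately have "of_vec (y' - ?y) = 0" by (simp only: inner_eq_zero_iff)
    moreover have "of_vec (y' - ?y) = of_vec y' - of_vec ?y"
      using x uc y'c by (intro of_vec_minus[of _ n]) auto
    ultimately have "of_vec y' = of_vec ?y" by (simp only: right_minus_eq)
    then show "y' = ?y" using x uc y'c to_vec_of_vec by (metis minus_carrier_vec)
  qed
  then show ?thesis using u(1) by blast
qed

section \<open>Covering numbers, convex hulls and approximation numbers of a matrix\<close>

lemma covering_number_attained:
  assumes "Metric_space M d" "finite T" "T \<subseteq> M" "0 \<le> \<epsilon>"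
  shows "\<exists>S. S \<subseteq> M \<and> finite S \<and> card S = covering_number M d \<epsilon> T \<and>
    T \<subseteq> (\<Union>x\<in>S. Metric_space.mcball M d x \<epsilon>)"
proof -
  interpret Metric_space M d by (rule assms)
  have "T \<subseteq> (\<Union>x\<in>T. mcball x \<epsilon>)" using assms by auto
  then have "\<exists>k S. S \<subseteq> M \<and> finite S \<and> card S = k \<and> T \<subseteq> (\<Union>x\<in>S. mcball x \<epsilon>)"
    using assms by blast
  from LeastI_ex[OF this] show ?thesis unfolding covering_number_def .
qed

text \<open>
  The case of an empty cover, where the entropy is \<open>ln 0 = 0\<close>, is why \<open>h\<close> has to be nonnegative.
\<close>
lemma entropy_le_if_coverable:
  assumes T: "T \<subseteq> carrier_vec n" and cov: "coverable (of_vec ` T) \<epsilon> h" and h: "0 \<le> h"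
  shows "entropy (carrier_vec n) l2_dist \<epsilon> T \<le> h"
proof -
  interpret Metric_space "carrier_vec n" l2_dist by (rule Metric_space_l2_dist)
  obtain S where S: "finite S" "real (card S) \<le> exp h"
    "\<And>x. x \<in> of_vec ` T \<Longrightarrow> \<exists>s\<in>S. dist s x \<le> \<epsilon>"
    using cov by (rule coverableE) blast
  let ?S = "to_vec n ` S"
  have "T \<subseteq> (\<Union>x\<in>?S. mcball x \<epsilon>)"
  proof
    fix t assume t: "t \<in> T"
    then have tc: "t \<in> carrier_vec n" using T by blast
    obtain s where s: "s \<in> S" "dist s (of_vec t) \<le> \<epsilon>" using S(3) t by blast
    have "l2_dist (to_vec n s) t = l2_norm (to_vec n (s - of_vec t))"
      using tc by (simp add: l2_dist_def to_vec_minus carrier_vecD[OF to_vec_carrier])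
    also have "\<dots> \<le> \<epsilon>" using l2_norm_to_vec_le[of n "s - of_vec t"] s by (simp add: dist_norm)
    finally show "t \<in> (\<Union>x\<in>?S. mcball x \<epsilon>)" using s tc by auto
  qed
  then have "covering_number (carrier_vec n) l2_dist \<epsilon> T \<le> card ?S"
    unfolding covering_number_def using S by (intro Least_le exI[of _ ?S]) auto
  also have "\<dots> \<le> card S" by (rule card_image_le[OF S(1)])
  finally have le: "real (covering_number (carrier_vec n) l2_dist \<epsilon> T) \<le> exp h" using S(2) by linarith
  show ?thesis
  proof (cases "covering_number (carrier_vec n) l2_dist \<epsilon> T = 0")
    case True
    then show ?thesis using h by (simp add: entropy_def)
  next
    case False
    then have "ln (real (covering_number (carrier_vec n) l2_dist \<epsilon> T)) \<le> ln (exp h)"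
      using le by (intro ln_mono) auto
    then show ?thesis by (simp add: entropy_def)
  qed
qed

lemma coord_sum: "coord (sum f A) i = (\<Sum>a\<in>A. coord (f a) i)"
  by (induction A rule: infinite_finite_induct) (simp_all add: zero_fsvec.rep_eq plus_fsvec.rep_eq)

lemma absconv_subset_carrier: "X \<in> carrier_mat n p \<Longrightarrow> absconv X \<subseteq> carrier_vec n"
  by (auto simp: absconv_def)

lemma of_vec_absconv_subset:
  assumes X: "X \<in> carrier_mat n p"
  shows "of_vec ` absconv X \<subseteq> abs_hull {..<p} (\<lambda>j. of_vec (col X j))"
proof
  fix z assume "z \<in> of_vec ` absconv X"
  then obtain \<beta> where \<beta>: "\<beta> \<in> carrier_vec p" "l1_norm \<beta> \<le> 1" "z = of_vec (X *\<^sub>v \<beta>)"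
    using X by (auto simp: absconv_def)
  have "z = (\<Sum>j<p. (\<beta> $ j) *\<^sub>R of_vec (col X j))"
  proof (rule fsvec_eqI)
    fix i
    have "coord z i = (if i < n then \<Sum>j<p. X $$ (i, j) * \<beta> $ j else 0)"
      using X \<beta> by (auto simp: coord_of_vec scalar_prod_def atLeast0LessThan)
    also have "\<dots> = (\<Sum>j<p. \<beta> $ j * coord (of_vec (col X j)) i)"
      using X by (auto simp: coord_of_vec intro!: sum.cong)
    finally show "coord z i = coord (\<Sum>j<p. (\<beta> $ j) *\<^sub>R of_vec (col X j)) i"
      by (simp add: coord_sum scaleR_fsvec.rep_eq)
  qed
  moreover have "(\<Sum>j<p. \<bar>\<beta> $ j\<bar>) \<le> 1" using \<beta> by (simp add: l1_norm_def)
  ultimately show "z \<in> abs_hull {..<p} (\<lambda>j. of_vec (col X j))"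
    unfolding abs_hull_def by (intro CollectI exI[of _ "\<lambda>j. \<beta> $ j"]) simp
qed

lemma approx_error_nonneg:
  assumes "X \<in> carrier_mat n p" "0 < p"
  shows "0 \<le> approx_error U X"
proof -
  have "l2_norm (orth_proj n (orth_compl n U) (col X 0)) \<le> approx_error U X"
    unfolding approx_error_def using assms by (intro Max_ge) auto
  moreover have "0 \<le> l2_norm (orth_proj n (orth_compl n U) (col X 0))"
    by (simp add: l2_norm_def)
  ultimately show ?thesis by linarith
qed

lemma approx_error_carrier:
  assumes X: "X \<in> carrier_mat n p" and p: "0 < p"
  shows "approx_error (carrier_vec n) X = 0"
proof -
  have "orth_proj n (orth_compl n (carrier_vec n)) x = 0\<^sub>v n" if x: "x \<in> carrier_vec n" for x
  proof -
    interpret V: vec_space "TYPE(real)" n .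
    have perp: "y = 0\<^sub>v n" if "y \<in> orth_compl n (carrier_vec n)" for y
    proof -
      have y: "y \<in> carrier_vec n" "y \<bullet> y = 0" using that by (auto simp: V.orthogonal_complement_def)
      then have "inner (of_vec y) (of_vec y) = 0" by (simp only: inner_of_vec[OF y(1,1)])
      then have "of_vec y = of_vec (0\<^sub>v n)" by (simp only: inner_eq_zero_iff of_vec_zero)
      then show ?thesis using to_vec_of_vec[OF y(1)] to_vec_of_vec[OF zero_carrier_vec[of n]] by metis
    qed
    have zero: "0\<^sub>v n \<in> orth_compl n (carrier_vec n)"
      by (auto simp: V.orthogonal_complement_def)
    have compl: "orth_compl n (carrier_vec n) = {0\<^sub>v n}" using zero perp by blast
    have "x - 0\<^sub>v n \<in> orth_compl n {0\<^sub>v n}"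
      using x by (auto simp: V.orthogonal_complement_def)
    then show ?thesis
      unfolding orth_proj_def compl by (intro the_equality) blast+
  qed
  then have "(\<lambda>j. l2_norm (orth_proj (dim_row X) (orth_compl (dim_row X) (carrier_vec n)) (col X j))) ` {..<dim_col X} = {0}"
    using X p by (auto simp: l2_norm_def L2_set_def image_iff)
  then show ?thesis unfolding approx_error_def by (simp only: Max_singleton)
qed

text \<open>
  The infimum in \<open>min_approx_error\<close> is replaced by an actual subspace at the price of the factor 2. The
  infimum is over a nonempty family because the full space has error 0, which bounds the approximation
  number by \<open>n\<close>.
\<close>
lemma approx_number_subspace:
  assumes X: "X \<in> carrier_mat n p" and p: "0 < p" and \<delta>: "0 < \<delta>"
  shows "\<exists>U \<in> subspaces_of_dim n (approx_number \<delta> X). approx_error U X < 2 * \<delta>"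
proof -
  have bdd: "bdd_below ((\<lambda>U. approx_error U X) ` S)" for S
    by (rule bdd_belowI[of _ 0]) (use approx_error_nonneg[OF X p] in auto)
  have "min_approx_error n X \<le> approx_error (carrier_vec n) X"
    unfolding min_approx_error_def using X carrier_vec_in_subspaces_of_dim[of n]
    by (intro cINF_lower bdd) auto
  then have n: "min_approx_error n X \<le> \<delta>" using approx_error_carrier[OF X p] \<delta> by simp
  have "approx_number \<delta> X \<le> n" unfolding approx_number_def by (rule Least_le) (rule n)
  then have ne: "subspaces_of_dim n (approx_number \<delta> X) \<noteq> {}" by (rule subspaces_of_dim_nonempty)
  have "min_approx_error (approx_number \<delta> X) X \<le> \<delta>" unfolding approx_number_def 
    by (rule LeastI[where P = "\<lambda>N. min_approx_error N X \<le> \<delta>", OF n])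
  then have "(INF U\<in>subspaces_of_dim n (approx_number \<delta> X). approx_error U X) < 2 * \<delta>"
    using \<delta> X by (simp add: min_approx_error_def)
  then show ?thesis using cINF_less_iff[OF ne bdd] by blast
qed

lemma approx_number_span:
  assumes X: "X \<in> carrier_mat n p" and p: "0 < p" and \<delta>: "0 < \<delta>"
  shows "\<exists>F. finite F \<and> card F \<le> approx_number \<delta> X \<and>
    (\<forall>j<p. \<exists>a\<in>span F. norm (of_vec (col X j) - a) \<le> 2 * \<delta>)"
proof -
  obtain U where U: "U \<in> subspaces_of_dim n (approx_number \<delta> X)" "approx_error U X < 2 * \<delta>"
    using approx_number_subspace[OF assms] by blast
  have Uc: "U \<subseteq> carrier_vec n" using U(1) vec_subspaceD(1) by (auto simp: subspaces_of_dim_def)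
  obtain F where F: "finite F" "card F \<le> approx_number \<delta> X" "of_vec ` U = span F"
    using vec_subspace_generators[OF U(1)] by blast
  have "\<exists>a\<in>span F. norm (of_vec (col X j) - a) \<le> 2 * \<delta>" if j: "j < p" for j
  proof -
    have x: "col X j \<in> carrier_vec n" using X j by auto
    obtain u where u: "u \<in> U" "orth_proj n (orth_compl n U) (col X j) = col X j - u"
      using orth_proj_orth_compl[OF U(1) x] by blast
    have "l2_norm (orth_proj n (orth_compl n U) (col X j)) \<le> approx_error U X"
      unfolding approx_error_def using X j by (intro Max_ge) auto
    then have "norm (of_vec (col X j - u)) \<le> 2 * \<delta>" using U(2) u(2) by (simp add: norm_of_vec)
    then have "norm (of_vec (col X j) - of_vec u) \<le> 2 * \<delta>"
      using of_vec_minus[OF x, of u] Uc u(1) by auto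
    then show ?thesis using F(3) u(1) by blast
  qed
  then show ?thesis using F(1,2) by blast
qed

text \<open>
  The centres of a minimal cover need not be columns. Choosing one column in each ball doubles the
  radius, but the new centres inherit the approximation properties of the columns.
\<close>
lemma column_net:
  assumes X: "X \<in> carrier_mat n p" and \<epsilon>: "0 \<le> \<epsilon>"
  defines "x \<equiv> \<lambda>j. of_vec (col X j)"
  shows "\<exists>y. (\<forall>j<p. y j \<in> x ` {..<p} \<and> norm (x j - y j) \<le> 2 * \<epsilon>) \<and>
    card (y ` {..<p}) \<le> covering_number (carrier_vec n) l2_dist \<epsilon> (set (cols X))"
proof -
  interpret Metric_space "carrier_vec n" l2_dist by (rule Metric_space_l2_dist)
  have col: "col X j \<in> carrier_vec n" if "j < p" for j using X that by auto
  have cols: "set (cols X) = col X ` {..<p}" using X by (auto simp: cols_def)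
  obtain S where S: "S \<subseteq> carrier_vec n" "finite S"
    "card S = covering_number (carrier_vec n) l2_dist \<epsilon> (set (cols X))"
    "set (cols X) \<subseteq> (\<Union>s\<in>S. mcball s \<epsilon>)"
    using covering_number_attained[OF Metric_space_l2_dist _ _ \<epsilon>, of "set (cols X)" n] col cols by auto
  have "\<exists>s\<in>S. dist (of_vec s) (x j) \<le> \<epsilon>" if j: "j < p" for j
  proof -
    obtain s where "s \<in> S" "col X j \<in> mcball s \<epsilon>" using S(4) cols j by blast
    then show ?thesis using l2_dist_of_vec[of s n "col X j"] by (auto simp: x_def)
  qed
  then obtain c where c: "\<And>j. j < p \<Longrightarrow> c j \<in> S" "\<And>j. j < p \<Longrightarrow> dist (of_vec (c j)) (x j) \<le> \<epsilon>"
    by metis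
  define rep where "rep = (\<lambda>s. SOME i. i < p \<and> c i = s)"
  have rep: "rep (c j) < p" "c (rep (c j)) = c j" if "j < p" for j
    using someI[of "\<lambda>i. i < p \<and> c i = c j" j] that by (auto simp: rep_def)
  show ?thesis
  proof (intro exI[of _ "\<lambda>j. x (rep (c j))"] conjI allI impI)
    fix j assume j: "j < p"
    show "x (rep (c j)) \<in> x ` {..<p}" using rep[OF j] by blast
    show "norm (x j - x (rep (c j))) \<le> 2 * \<epsilon>"
      using dist_triangle3[of "x j" "x (rep (c j))" "of_vec (c j)"] c(2)[OF j]
        c(2)[OF rep(1)[OF j]] rep(2)[OF j] by (simp add: dist_norm)
  next
    have "(\<lambda>j. x (rep (c j))) ` {..<p} \<subseteq> (\<lambda>s. x (rep s)) ` S" using c(1) by auto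
    then have "card ((\<lambda>j. x (rep (c j))) ` {..<p}) \<le> card ((\<lambda>s. x (rep s)) ` S)"
      using S(2) by (intro card_mono) auto
    also have "\<dots> \<le> card S" by (rule card_image_le[OF S(2)])
    finally show "card ((\<lambda>j. x (rep (c j))) ` {..<p}) \<le> covering_number (carrier_vec n) l2_dist \<epsilon> (set (cols X))"
      using S(3) by simp
  qed
qed

section \<open>Choice of the scale and the entropy bound\<close>

text \<open>
  The two requirements on the target radius: the first says that the balanced scale \<open>\<delta>\<close> is at least \<open>\<epsilon>\<close>, so
  that \<open>log(1/\<delta>)\<close> is at most \<open>log(1/\<epsilon>)\<close>; the second bounds the logarithm of the number of net points.
  Both hold for small \<open>\<epsilon>\<close> because powers of \<open>\<epsilon>\<close> beat powers of logarithms and constants.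
\<close>
lemma eventually_scale_conditions:
  fixes V W w A \<kappa> :: real
  assumes "V > 0" "W > 0" "A > 0" "\<kappa> > 0"
  shows "\<forall>\<^sub>F \<epsilon> in at_right 0. \<epsilon> powr (2 + W) \<le> \<kappa> * \<epsilon>\<^sup>2 * ln (1 / \<epsilon>) powr (w - 1) \<and>
    ln (2 * (A * (\<epsilon> / 4) powr (- V)) + 1) \<le> (V + 1) * ln (1 / \<epsilon>)"
proof (rule eventually_conj)
  have "((\<lambda>\<epsilon>. \<epsilon> powr W * ln (1 / \<epsilon>) powr (1 - w)) \<longlongrightarrow> 0) (at_right (0::real))"
    using assms by real_asymp
  then have "\<forall>\<^sub>F \<epsilon> in at_right 0. \<epsilon> powr W * ln (1 / \<epsilon>) powr (1 - w) < \<kappa>"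
    using assms by (intro order_tendstoD) auto
  moreover have "\<forall>\<^sub>F \<epsilon> in at_right (0::real). 0 < \<epsilon> \<and> \<epsilon> < 1"
    by (intro eventually_conj eventually_at_right_less) (simp add: eventually_at_right_field, rule exI[of _ 1], simp)
  ultimately show "\<forall>\<^sub>F \<epsilon> in at_right 0. \<epsilon> powr (2 + W) \<le> \<kappa> * \<epsilon>\<^sup>2 * ln (1 / \<epsilon>) powr (w - 1)"
  proof eventually_elim
    case (elim \<epsilon>)
    define L where "L = ln (1 / \<epsilon>)"
    have L: "L > 0" using elim by (simp add: L_def)
    have "\<epsilon> powr (2 + W) = \<epsilon>\<^sup>2 * (\<epsilon> powr W * L powr (1 - w)) * L powr (w - 1)"
      using L elim by (simp add: powr_add powr_diff powr_realpow)
    also have "\<dots> \<le> \<epsilon>\<^sup>2 * \<kappa> * L powr (w - 1)"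
      using elim by (intro mult_right_mono mult_left_mono) (auto simp: L_def)
    finally show ?case by (simp add: L_def mult_ac)
  qed
  have "((\<lambda>\<epsilon>. \<epsilon> powr (V + 1) * (2 * (A * (\<epsilon> / 4) powr (- V)) + 1)) \<longlongrightarrow> 0) (at_right (0::real))"
    using assms by real_asymp
  then have "\<forall>\<^sub>F \<epsilon> in at_right 0. \<epsilon> powr (V + 1) * (2 * (A * (\<epsilon> / 4) powr (- V)) + 1) < 1"
    by (intro order_tendstoD) auto
  moreover have "\<forall>\<^sub>F \<epsilon> in at_right (0::real). 0 < \<epsilon>" by (rule eventually_at_right_less)
  ultimately show "\<forall>\<^sub>F \<epsilon> in at_right 0.
      ln (2 * (A * (\<epsilon> / 4) powr (- V)) + 1) \<le> (V + 1) * ln (1 / \<epsilon>)"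
  proof eventually_elim
    case (elim \<epsilon>)
    define Y where "Y = 2 * (A * (\<epsilon> / 4) powr (- V)) + 1"
    have Y: "Y > 0" using assms elim by (simp add: Y_def add_pos_pos)
    have "ln (\<epsilon> powr (V + 1) * Y) \<le> 0" using elim Y by (simp add: Y_def ln_le_zero_iff)
    then have "(V + 1) * ln \<epsilon> + ln Y \<le> 0" using elim Y by (simp add: ln_mult ln_powr)
    then have "ln Y \<le> (V + 1) * ln (1 / \<epsilon>)" using elim by (simp add: ln_div algebra_simps)
    then show ?case by (simp only: Y_def)
  qed
qed

text \<open>
  The scale \<open>\<delta>\<close> solves \<open>27 c \<delta> sqrt ((V + 1) L / N) = \<epsilon> / 2\<close> with \<open>N = B L\<^sup>w \<delta>\<^bsup>-W\<^esup>\<close>, that is,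
  \<open>\<delta>\<^bsup>2+W\<^esup> = \<kappa> \<epsilon>\<^sup>2 L\<^bsup>w-1\<^esup>\<close>; this is where \<open>\<kappa>\<close> comes from. The other half of \<open>\<epsilon>\<close> is
  used up by the net. The constant \<open>c = 2 / \<epsilon>0\<close> serves two purposes: it is at least 2, which accommodates
  the factor from \<open>approx_number_span\<close>, and at scales above \<open>\<epsilon>0\<close>, about which the hypotheses say nothing,
  it makes the zero subspace accurate enough, because the columns have norm at most 1.
\<close>
proposition coverable_absconv:
  fixes V W w A B \<epsilon>0 \<epsilon> :: real
  assumes pos: "V > 0" "W > 0" "w \<ge> 0" "A > 0" "B > 0" "0 < \<epsilon>0" "\<epsilon>0 < 1"
  defines "c \<equiv> 2 / \<epsilon>0"
  defines "\<kappa> \<equiv> B / ((54 * c)\<^sup>2 * (V + 1))"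
  assumes \<epsilon>: "0 < \<epsilon>" "\<epsilon> \<le> \<epsilon>0"
    and scale: "\<epsilon> powr (2 + W) \<le> \<kappa> * \<epsilon>\<^sup>2 * ln (1 / \<epsilon>) powr (w - 1)"
    and net: "ln (2 * (A * (\<epsilon> / 4) powr (- V)) + 1) \<le> (V + 1) * ln (1 / \<epsilon>)"
    and X: "X \<in> carrier_mat n p"
    and col: "\<And>j. j < p \<Longrightarrow> l2_norm (col X j) \<le> 1"
    and cov: "\<And>e. 0 < e \<Longrightarrow> e \<le> \<epsilon>0 \<Longrightarrow>
      real (covering_number (carrier_vec n) l2_dist e (set (cols X))) \<le> A * e powr (- V)"
    and apx: "\<And>e. 0 < e \<Longrightarrow> e \<le> \<epsilon>0 \<Longrightarrow>
      real (approx_number e X) \<le> B * e powr (- W) * ln (1 / e) powr w"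
  shows "coverable (of_vec ` absconv X) \<epsilon>
    (chain_const W * B * \<kappa> powr (- (W / (2 + W))) * \<epsilon> powr (- (2 * W / (2 + W)))
      * ln (1 / \<epsilon>) powr (2 * w / (2 + W)) * ln (1 / \<epsilon>) powr (W / (2 + W)))"
proof -
  define L where "L = ln (1 / \<epsilon>)"
  have \<epsilon>1: "\<epsilon> < 1" using \<epsilon> pos by simp
  have L: "L > 0" using \<epsilon> \<epsilon>1 by (simp add: L_def)
  have c: "c \<ge> 2" "c > 0" using pos by (simp_all add: c_def field_simps)
  have \<kappa>: "\<kappa> > 0" using pos c by (simp add: \<kappa>_def)
  define \<delta> where "\<delta> = (\<kappa> * \<epsilon>\<^sup>2 * L powr (w - 1)) powr (1 / (2 + W))"
  have base: "\<kappa> * \<epsilon>\<^sup>2 * L powr (w - 1) > 0" using \<kappa> \<epsilon> L by simp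
  have \<delta>: "\<delta> > 0" using \<kappa> \<epsilon> L by (simp add: \<delta>_def)
  have \<delta>_pow: "\<delta> powr (2 + W) = \<kappa> * \<epsilon>\<^sup>2 * L powr (w - 1)"
    using pos base \<kappa> \<epsilon> L by (simp add: \<delta>_def powr_powr)
  have \<epsilon>\<delta>: "\<epsilon> \<le> \<delta>"
  proof -
    have "\<epsilon> = (\<epsilon> powr (2 + W)) powr (1 / (2 + W))" using pos \<epsilon> by (simp add: powr_powr)
    also have "\<dots> \<le> \<delta>"
      unfolding \<delta>_def using scale pos by (intro powr_mono2) (auto simp: L_def)
    finally show ?thesis .
  qed
  define N where "N = B * L powr w * \<delta> powr (- W)"
  have N: "N > 0" using pos L \<delta> by (simp add: N_def)
  define x where "x = (\<lambda>j. of_vec (col X j))"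
  obtain y where y: "\<And>j. j < p \<Longrightarrow> y j \<in> x ` {..<p}" "\<And>j. j < p \<Longrightarrow> norm (x j - y j) \<le> 2 * (\<epsilon> / 4)"
    "card (y ` {..<p}) \<le> covering_number (carrier_vec n) l2_dist (\<epsilon> / 4) (set (cols X))"
    using column_net[OF X, of "\<epsilon> / 4"] \<epsilon> unfolding x_def by auto
  have x1: "norm (x j) \<le> 1" if "j < p" for j using col[OF that] by (simp add: x_def norm_of_vec)
  have card_y: "ln (2 * real (card (y ` {..<p})) + 1) \<le> (V + 1) * L"
  proof -
    have "real (card (y ` {..<p})) \<le> A * (\<epsilon> / 4) powr (- V)"
      using y(3) cov[of "\<epsilon> / 4"] \<epsilon> by simp
    then have "ln (2 * real (card (y ` {..<p})) + 1) \<le> ln (2 * (A * (\<epsilon> / 4) powr (- V)) + 1)"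
      by (intro ln_mono) auto
    then show ?thesis using net by (simp add: L_def)
  qed
  have approx: "\<exists>F. finite F \<and> real (card F) \<le> N * 2 powr (- (real k * W)) \<and>
      (\<forall>j\<in>{..<p}. \<exists>a\<in>span F. norm (y j - a) \<le> c * \<delta> * 2 ^ k)" for k
  proof -
    define d where "d = \<delta> * 2 ^ k"
    have d: "d > 0" "\<delta> \<le> d" using \<delta> by (simp_all add: d_def)
    have Nd: "N * 2 powr (- (real k * W)) = B * L powr w * d powr (- W)"
      using \<delta> by (simp add: N_def d_def powr_mult powr_powr powr_realpow[symmetric] mult_ac)
    show ?thesis
    proof (cases "d \<le> \<epsilon>0 \<and> 0 < p")
      case True
      then have d0: "d \<le> \<epsilon>0" and p: "0 < p" by simp_all
      obtain F where F: "finite F" "card F \<le> approx_number d X"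
        "\<And>j. j < p \<Longrightarrow> \<exists>a\<in>span F. norm (x j - a) \<le> 2 * d"
        using approx_number_span[OF X p d(1)] unfolding x_def by blast
      have "real (card F) \<le> B * d powr (- W) * ln (1 / d) powr w"
        using F(2) apx[OF d(1) d0] by linarith
      also have "\<dots> \<le> B * d powr (- W) * L powr w"
      proof -
        have "ln (1 / d) \<le> L" unfolding L_def using \<epsilon> \<epsilon>\<delta> d by (intro ln_mono) (auto simp: frac_le)
        moreover have "0 \<le> ln (1 / d)" using d d0 pos by simp
        ultimately show ?thesis using pos by (intro mult_left_mono powr_mono2) auto
      qed
      finally have "real (card F) \<le> N * 2 powr (- (real k * W))" unfolding Nd by (simp add: mult_ac)
      moreover have "\<exists>a\<in>span F. norm (y j - a) \<le> c * \<delta> * 2 ^ k" if j: "j < p" for j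
      proof -
        obtain i where "i < p" "y j = x i" using y(1)[OF j] by auto
        then obtain a where "a \<in> span F" "norm (y j - a) \<le> 2 * d" using F(3) by metis
        moreover have "2 * d \<le> c * d" using c d by simp
        ultimately show ?thesis by (intro bexI[of _ a]) (auto simp: d_def mult_ac)
      qed
      ultimately show ?thesis using F(1) by blast
    next
      case False
      have "norm (y j) \<le> c * \<delta> * 2 ^ k" if j: "j < p" for j
      proof -
        have "norm (y j) \<le> 1" using y(1)[OF j] x1 by auto
        also have "1 \<le> c * d" using False j pos d by (simp add: c_def field_simps)
        finally show ?thesis by (simp add: d_def mult_ac)
      qed
      then show ?thesis using N by (intro exI[of _ "{}"]) simp
    qed
  qed
  have chain: "coverable (abs_hull {..<p} y) (27 * (c * \<delta>) * sqrt ((V + 1) * L / N)) (chain_const W * N)"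
    by (rule coverable_chaining[OF _ pos(2) N _ _ card_y approx]) (use c \<delta> pos L in auto)
  have radius: "27 * (c * \<delta>) * sqrt ((V + 1) * L / N) = \<epsilon> / 2"
  proof -
    have "L powr (w - 1) * L = L powr w" using L by (simp add: powr_diff)
    moreover have "\<delta>\<^sup>2 * \<delta> powr W = \<delta> powr (2 + W)" using \<delta> by (simp add: powr_add powr_realpow)
    ultimately have key: "(54 * c)\<^sup>2 * (V + 1) * L * (\<delta>\<^sup>2 * \<delta> powr W) = \<epsilon>\<^sup>2 * B * L powr w"
      using pos c by (simp add: \<delta>_pow \<kappa>_def mult_ac)
    have "(27 * (c * \<delta>))\<^sup>2 * ((V + 1) * L / N) = ((54 * c)\<^sup>2 * (V + 1) * L * (\<delta>\<^sup>2 * \<delta> powr W)) / (4 * (B * L powr w))"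
      using pos L \<delta> by (simp add: N_def powr_minus field_simps power2_eq_square)
    also have "\<dots> = (\<epsilon> / 2)\<^sup>2" unfolding key using pos L by (simp add: power2_eq_square)
    finally have sq: "(27 * (c * \<delta>))\<^sup>2 * ((V + 1) * L / N) = (\<epsilon> / 2)\<^sup>2" .
    have "0 \<le> 27 * (c * \<delta>)" using c \<delta> by simp
    then have "27 * (c * \<delta>) * sqrt ((V + 1) * L / N) = sqrt ((27 * (c * \<delta>))\<^sup>2 * ((V + 1) * L / N))"
      by (simp only: real_sqrt_mult real_sqrt_abs abs_of_nonneg)
    then show ?thesis using \<epsilon> by (simp only: sq real_sqrt_abs)
  qed
  have N_eq: "N = B * \<kappa> powr (- (W / (2 + W))) * \<epsilon> powr (- (2 * W / (2 + W))) * L powr (2 * w / (2 + W)) * L powr (W / (2 + W))"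
  proof -
    have \<epsilon>2: "\<epsilon>\<^sup>2 powr a = \<epsilon> powr (2 * a)" for a
      using \<epsilon> by (simp flip: powr_powr)
    have "\<delta> powr (- W) = (\<kappa> * \<epsilon>\<^sup>2 * L powr (w - 1)) powr (- (W / (2 + W)))"
      by (simp add: \<delta>_def powr_powr)
    also have "\<dots> = \<kappa> powr (- (W / (2 + W))) * \<epsilon> powr (- (2 * W / (2 + W))) * L powr (- ((w - 1) * W / (2 + W)))"
      using \<kappa> \<epsilon> L by (simp add: powr_mult \<epsilon>2 powr_powr)
    finally have "N = B * \<kappa> powr (- (W / (2 + W))) * \<epsilon> powr (- (2 * W / (2 + W))) *
      (L powr w * L powr (- ((w - 1) * W / (2 + W))))" by (simp add: N_def mult_ac)
    also have "L powr w * L powr (- ((w - 1) * W / (2 + W))) = L powr (2 * w / (2 + W) + W / (2 + W))"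
    proof -
      have "w - (w - 1) * W / (2 + W) = (w * (2 + W) - (w - 1) * W) / (2 + W)"
        using pos by (simp add: diff_divide_distrib)
      also have "w * (2 + W) - (w - 1) * W = 2 * w + W" by (simp add: algebra_simps)
      finally have "w - (w - 1) * W / (2 + W) = 2 * w / (2 + W) + W / (2 + W)"
        by (simp add: add_divide_distrib)
      then show ?thesis by (simp add: powr_add[symmetric])
    qed
    finally show ?thesis by (simp add: powr_add mult_ac)
  qed
  have "coverable (abs_hull {..<p} x) (\<epsilon> / 2 + 2 * (\<epsilon> / 4)) (chain_const W * N)"
    by (rule coverable_near[OF chain[unfolded radius]], rule abs_hull_near[OF y(2)]) (use \<epsilon> in auto)
  then have "coverable (of_vec ` absconv X) \<epsilon> (chain_const W * N)"
    by (rule coverable_mono) (use of_vec_absconv_subset[OF X] in \<open>auto simp: x_def\<close>)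
  then show ?thesis unfolding N_eq L_def by (simp add: mult_ac)
qed

theorem theorem3p3:
  fixes V W w A B \<epsilon>0 :: real
  assumes "V > 0" and "W > 0" and "w \<ge> 0" and "A > 0" and "B > 0" and "0 < \<epsilon>0" and "\<epsilon>0 < 1"
  shows "\<exists>C \<epsilon>1 :: real. 0 < \<epsilon>1 \<and> \<epsilon>1 < 1 \<and>
    (\<forall>n p :: nat. \<forall>X \<in> carrier_mat n p.
       (\<forall>j<p. l2_norm (col X j) \<le> 1) \<longrightarrow>
       (\<forall>\<epsilon>\<in>{0<..\<epsilon>0}.
          real (covering_number (carrier_vec n) l2_dist \<epsilon> (set (cols X))) \<le> A * \<epsilon> powr (- V)) \<longrightarrow>
       (\<forall>\<epsilon>\<in>{0<..\<epsilon>0}.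
          real (approx_number \<epsilon> X) \<le> B * \<epsilon> powr (- W) * ln (1 / \<epsilon>) powr w) \<longrightarrow>
       (\<forall>\<epsilon>\<in>{0<..\<epsilon>1}.
          entropy (carrier_vec n) l2_dist \<epsilon> (absconv X)
            \<le> C * \<epsilon> powr (- (2 * W / (2 + W)))
                * ln (1 / \<epsilon>) powr (2 * w / (2 + W)) * ln (1 / \<epsilon>) powr (W / (2 + W))))"
proof -
  define \<kappa> where "\<kappa> = B / ((54 * (2 / \<epsilon>0))\<^sup>2 * (V + 1))"
  have \<kappa>: "\<kappa> > 0" using assms by (simp add: \<kappa>_def)
  define C where "C = chain_const W * B * \<kappa> powr (- (W / (2 + W)))"
  have C: "C \<ge> 0" using assms chain_const_pos[of W] by (simp add: C_def)
  obtain b where b: "b > 0" "\<And>\<epsilon>. 0 < \<epsilon> \<Longrightarrow> \<epsilon> < b \<Longrightarrow>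
      \<epsilon> powr (2 + W) \<le> \<kappa> * \<epsilon>\<^sup>2 * ln (1 / \<epsilon>) powr (w - 1) \<and>
      ln (2 * (A * (\<epsilon> / 4) powr (- V)) + 1) \<le> (V + 1) * ln (1 / \<epsilon>)"
    using eventually_scale_conditions[OF assms(1,2,4) \<kappa>, of w] unfolding eventually_at_right_field by blast
  define \<epsilon>1 where "\<epsilon>1 = min (b / 2) \<epsilon>0"
  have \<epsilon>1: "0 < \<epsilon>1" "\<epsilon>1 < 1" "\<epsilon>1 < b" "\<epsilon>1 \<le> \<epsilon>0" using assms b(1) by (auto simp: \<epsilon>1_def)
  show ?thesis
  proof (rule exI[of _ C], rule exI[of _ \<epsilon>1], intro conjI allI ballI impI \<epsilon>1(1,2))
    fix n p :: nat and X :: "real mat" and \<epsilon> :: real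
    assume X: "X \<in> carrier_mat n p" and col: "\<forall>j<p. l2_norm (col X j) \<le> 1"
      and cov: "\<forall>\<epsilon>\<in>{0<..\<epsilon>0}.
          real (covering_number (carrier_vec n) l2_dist \<epsilon> (set (cols X))) \<le> A * \<epsilon> powr (- V)"
      and apx: "\<forall>\<epsilon>\<in>{0<..\<epsilon>0}. real (approx_number \<epsilon> X) \<le> B * \<epsilon> powr (- W) * ln (1 / \<epsilon>) powr w"
      and e: "\<epsilon> \<in> {0<..\<epsilon>1}"
    have \<epsilon>: "0 < \<epsilon>" "\<epsilon> \<le> \<epsilon>0" "\<epsilon> < b" using e \<epsilon>1 by auto
    have "coverable (of_vec ` absconv X) \<epsilon> (C * \<epsilon> powr (- (2 * W / (2 + W)))
        * ln (1 / \<epsilon>) powr (2 * w / (2 + W)) * ln (1 / \<epsilon>) powr (W / (2 + W)))"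
      unfolding C_def \<kappa>_def
      by (rule coverable_absconv[OF assms \<epsilon>(1,2) _ _ X])
        (use b(2)[OF \<epsilon>(1,3)] col cov apx in \<open>auto simp: \<kappa>_def\<close>)
    then show "entropy (carrier_vec n) l2_dist \<epsilon> (absconv X) \<le> C * \<epsilon> powr (- (2 * W / (2 + W)))
        * ln (1 / \<epsilon>) powr (2 * w / (2 + W)) * ln (1 / \<epsilon>) powr (W / (2 + W))"
      by (rule entropy_le_if_coverable[OF absconv_subset_carrier[OF X]]) (use C in simp)
  qed
qed

end
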